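(* Let $k_1,k_2\in\mathbb{N}$ and $\beta=(\beta_{-2k_1},\beta_{-2k_1+1},\ldots,\beta_{2k_2})$ be a real sequence with $\beta_{-2k_1}>0$. The following are equivalent: (1) There exists a representing measure for $\beta$ supported on $\mathbb{R}\setminus\{0\}$. (2) There exists a $(\operatorname{rank}\beta)$-atomic representing measure for $\beta$ supported on $\mathbb{R}\setminus\{0\}$. (3) $\beta$ is recursively generated. (4) $M(-k_1,k_2)\succeq0$ and either (a) $M(-k_1,k_2)\succ 0$, or (b) $\operatorname{rank}M(-k_1,k_2)=\operatorname{rank}M(-k_1,k_2-1)=\operatorname{rank}M(-k_1+1,k_2)$. Moreover, suppose $\beta$ has a representing measure supported on $\mathbb{R}\setminus\{0\}$ and let $r=\operatorname{rank}\beta$. (i) If $r\le k_1+k_2$, then the representing measure is unique and of the form $\mu=\sum_{i=1}^r\rho_i\delta_{x_i}$, where $x_1,\ldots,x_r$ are the roots of the generating polynomial of $\beta$ and $\rho_1,\ldots,\rho_r>0$. (ii) If $r=k_1+k_2+1$, then there are infinitely many $(k_1+k_2+1)$-atomic representing measures for $\beta$. Writing $M(-k_1,k_2)=(\mathbf{v_0}\ \mathbf{v_1}\ \cdots\ \mathbf{v_{k_1+k_2}})$ in columns, they are obtained as follows: choose any $\beta_{2k_2+1}\in\mathbb{R}$ which is not equal to $v^TC^{-1}v$ in case $C$ is invertible, where $C=(\mathbf{v_1}(0{:}k_1+k_2-1)\ \cdots\ \mathbf{v_{k_1+k_2}}(0{:}k_1+k_2-1))$ and $v=(\beta_{-k_1+k_2+1},\ldots,\beta_{2k_2})^T$;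 define $\beta_{2k_2+2}=u^T M(-k_1,k_2)^{-1}u$ with $u=(\beta_{-k_1+k_2+1},\ldots,\beta_{2k_2},\beta_{2k_2+1})^T$; then the measure is the unique representing measure of $\widetilde\beta=(\beta_{-2k_1},\ldots,\beta_{2k_2+1},\beta_{2k_2+2})$ given as in (i), namely $\sum_i\rho_i\delta_{x_i}$ with $x_i$ the roots of the generating polynomial of $\widetilde\beta$ and $\rho_i>0$.
   Context: A representing measure for $\beta=(\beta_{-2k_1},\ldots,\beta_{2k_2})$ supported on $\mathbb{R}\setminus\{0\}$ is a positive Borel measure $\mu$ on $\mathbb{R}$ with $\mu(\{0\})=0$ and $\beta_i=\int x^i\,d\mu$ for all integers $-2k_1\le i\le 2k_2$. For $-k_1\le n_1\le n_2\le k_2$, $M(n_1,n_2)=(\beta_{i+j})_{i,j=n_1}^{n_2}$. For $x\in\mathbb{R}^m$, $x(0{:}i)$ denotes its first $i+1$ coordinates. Notions for $\beta$ (rank, singular, prg, nrg, recursively generated, generating polynomial) are those of the sequence $w=(w_0,\ldots,w_{2n})$, $w_i=\beta_{i-2k_1}$, $n=k_1+k_2$ (so $A_w=M(-k_1,k_2)$), defined as follows. $A_w=(w_{i+j})_{i,j=0}^n$ has columns $\mathbf{w_0},\ldots,\mathbf{w_n}$; $A_w(m)=(w_{i+j})_{i,j=0}^m$, $A_w[m]=(w_{i+j})_{i,j=n-m}^n$. $\operatorname{rank}w=n+1$ if $A_w$ is nonsingular, otherwise the least $i$ with $\mathbf{w_i}\in\operatorname{span}\{\mathbf{w_0},\ldots,\mathbf{w_{i-1}}\}$;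 $w$ is singular if $\operatorname{rank}w<n+1$. With $r=\operatorname{rank}w$: $w$ is prg if $A_w(r-1)\succ0$ and, when $r<n+1$, with $(\varphi_0,\ldots,\varphi_{r-1})^T:=A_w(r-1)^{-1}(w_r,\ldots,w_{2r-1})^T$, $w_j=\varphi_0w_{j-r}+\cdots+\varphi_{r-1}w_{j-1}$ for $j=r,\ldots,2n$; for singular $w$ the generating polynomial is $x^r-\sum_{i=0}^{r-1}\varphi_ix^i$. With $r=\operatorname{rank}(w_{2n},\ldots,w_0)$: $w$ is nrg if $A_w[r-1]\succ0$ and, when $r<n+1$, with $(\psi_0,\ldots,\psi_{r-1})^T:=A_w[r-1]^{-1}(w_{2n-2r+1},\ldots,w_{2n-r})^T$, $w_{2n-r-j}=\psi_0w_{2n-r+1-j}+\cdots+\psi_{r-1}w_{2n-j}$ for $j=0,\ldots,2n-r$. $w$ is recursively generated if it is prg and nrg. *)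

theory Defs
  imports "HOL-Probability.Probability" "HOL-Computational_Algebra.Polynomial"
          "Jordan_Normal_Form.DL_Rank" "Jordan_Normal_Form.Gauss_Jordan_Elimination"
begin

definition psd_mat :: "real mat \<Rightarrow> bool" where
  "psd_mat A \<longleftrightarrow> A \<in> carrier_mat (dim_row A) (dim_row A) \<and>
     (\<forall>v \<in> carrier_vec (dim_row A). v \<bullet> (A *\<^sub>v v) \<ge> 0)"

definition pd_mat :: "real mat \<Rightarrow> bool" where
  "pd_mat A \<longleftrightarrow> A \<in> carrier_mat (dim_row A) (dim_row A) \<and>
     (\<forall>v \<in> carrier_vec (dim_row A). v \<noteq> 0\<^sub>v (dim_row A) \<longrightarrow> v \<bullet> (A *\<^sub>v v) > 0)"

definition mat_rank :: "real mat \<Rightarrow> nat" where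
  "mat_rank A = vec_space.rank (dim_row A) A"

definition inv_mat :: "real mat \<Rightarrow> real mat" where
  "inv_mat A = the (mat_inverse A)"

text \<open>hank w a s = (w_(a+i+j))_(i,j<s). So A_w = hank w 0 (n+1), A_w(m) = hank w 0 (m+1),
  A_w[m] = hank w (2*(n-m)) (m+1).\<close>
definition hank :: "(nat \<Rightarrow> real) \<Rightarrow> nat \<Rightarrow> nat \<Rightarrow> real mat" where
  "hank w a s = mat s s (\<lambda>(i,j). w (a + i + j))"

definition seq_rank :: "(nat \<Rightarrow> real) \<Rightarrow> nat \<Rightarrow> nat" where
  "seq_rank w n = (if det (hank w 0 (n+1)) \<noteq> 0 then n + 1
     else (LEAST i. \<exists>c :: nat \<Rightarrow> real. col (hank w 0 (n+1)) i =
              finsum_vec TYPE(real) (n+1) (\<lambda>j. c j \<cdot>\<^sub>v col (hank w 0 (n+1)) j) {..<i}))"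

definition seq_singular :: "(nat \<Rightarrow> real) \<Rightarrow> nat \<Rightarrow> bool" where
  "seq_singular w n \<longleftrightarrow> seq_rank w n < n + 1"

definition prg_phi :: "(nat \<Rightarrow> real) \<Rightarrow> nat \<Rightarrow> real vec" where
  "prg_phi w n = (let r = seq_rank w n in
     inv_mat (hank w 0 r) *\<^sub>v vec r (\<lambda>i. w (r + i)))"

definition prg :: "(nat \<Rightarrow> real) \<Rightarrow> nat \<Rightarrow> bool" where
  "prg w n \<longleftrightarrow> (let r = seq_rank w n; \<phi> = prg_phi w n in
     pd_mat (hank w 0 r) \<and>
     (r < n + 1 \<longrightarrow> (\<forall>j \<in> {r..2*n}. w j = (\<Sum>i<r. \<phi> $ i * w (j - r + i)))))"

text \<open>Generating polynomial x^r - sum_(i<r) phi_i x^i (for singular w).\<close>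
definition gen_poly :: "(nat \<Rightarrow> real) \<Rightarrow> nat \<Rightarrow> real poly" where
  "gen_poly w n = (let r = seq_rank w n; \<phi> = prg_phi w n in
     monom 1 r - (\<Sum>i<r. monom (\<phi> $ i) i))"

definition nrg :: "(nat \<Rightarrow> real) \<Rightarrow> nat \<Rightarrow> bool" where
  "nrg w n \<longleftrightarrow> (let r = seq_rank (\<lambda>i. w (2*n - i)) n;
       \<psi> = inv_mat (hank w (2*(n+1-r)) r) *\<^sub>v vec r (\<lambda>i. w (2*n - 2*r + 1 + i)) in
     pd_mat (hank w (2*(n+1-r)) r) \<and>
     (r < n + 1 \<longrightarrow> (\<forall>j \<in> {0..2*n-r}.
        w (2*n - r - j) = (\<Sum>i<r. \<psi> $ i * w (2*n - r + 1 - j + i)))))"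

definition rec_gen :: "(nat \<Rightarrow> real) \<Rightarrow> nat \<Rightarrow> bool" where
  "rec_gen w n \<longleftrightarrow> prg w n \<and> nrg w n"

definition wseq :: "nat \<Rightarrow> (int \<Rightarrow> real) \<Rightarrow> nat \<Rightarrow> real" where
  "wseq k1 \<beta> i = \<beta> (int i - 2 * int k1)"

definition Mb :: "(int \<Rightarrow> real) \<Rightarrow> int \<Rightarrow> int \<Rightarrow> real mat" where
  "Mb \<beta> n1 n2 = mat (nat (n2 - n1 + 1)) (nat (n2 - n1 + 1))
      (\<lambda>(i,j). \<beta> (n1 + int i + n1 + int j))"

definition beta_rank :: "nat \<Rightarrow> nat \<Rightarrow> (int \<Rightarrow> real) \<Rightarrow> nat" where
  "beta_rank k1 k2 \<beta> = seq_rank (wseq k1 \<beta>) (k1 + k2)"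

definition beta_rec_gen :: "nat \<Rightarrow> nat \<Rightarrow> (int \<Rightarrow> real) \<Rightarrow> bool" where
  "beta_rec_gen k1 k2 \<beta> \<longleftrightarrow> rec_gen (wseq k1 \<beta>) (k1 + k2)"

definition beta_gen_poly :: "nat \<Rightarrow> nat \<Rightarrow> (int \<Rightarrow> real) \<Rightarrow> real poly" where
  "beta_gen_poly k1 k2 \<beta> = gen_poly (wseq k1 \<beta>) (k1 + k2)"

definition rep_measure :: "nat \<Rightarrow> nat \<Rightarrow> (int \<Rightarrow> real) \<Rightarrow> real measure \<Rightarrow> bool" where
  "rep_measure k1 k2 \<beta> M \<longleftrightarrow> sets M = sets borel \<and> emeasure M {0} = 0 \<and>
     (\<forall>i \<in> {-2 * int k1 .. 2 * int k2}.
        integrable M (\<lambda>x. x powi i) \<and> (\<integral>x. x powi i \<partial>M) = \<beta> i)"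

definition discrete_measure_on :: "real measure \<Rightarrow> real set \<Rightarrow> (real \<Rightarrow> real) \<Rightarrow> bool" where
  "discrete_measure_on M X \<rho> \<longleftrightarrow> finite X \<and> (\<forall>x \<in> X. \<rho> x > 0) \<and>
     (\<forall>A \<in> sets M. emeasure M A = (\<Sum>x \<in> X \<inter> A. ennreal (\<rho> x)))"

definition atomic_measure :: "real measure \<Rightarrow> nat \<Rightarrow> bool" where
  "atomic_measure M r \<longleftrightarrow> (\<exists>X \<rho>. card X = r \<and> discrete_measure_on M X \<rho>)"

end

theory Submission
  imports Defs "HOL-Computational_Algebra.Fundamental_Theorem_Algebra"
begin

unbundle no vec_syntax

text \<open>Identify \<open>w\<close> with the functional \<open>x^i \<mapsto> w_i\<close> on polynomials of degree at most \<open>2n\<close>; the kernel of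
  a Hankel matrix then consists of polynomials. In the singular case every condition of the theorem
  amounts to the existence of a monic polynomial \<open>p\<close> of degree at most \<open>n\<close> with \<open>p(0) \<noteq> 0\<close> that
  annihilates all products of degree at most \<open>2n\<close>, the functional being positive definite below
  the degree of \<open>p\<close>. If \<open>p\<close> had a factor \<open>(x - a)^2 + b^2\<close>, say \<open>p = ((x - a)^2 + b^2) h\<close>, then
  \<open>0 = L(p h) = L(((x - a) h)^2) + b^2 L(h^2) > 0\<close>; hence \<open>p\<close> has simple real roots, and Lagrange
  interpolation turns the functional into a positive combination of point evaluations at these roots.
  In the definite case a flat extension reduces to the singular one, and the excluded value of
  \<open>\<beta>_(2k_2+1)\<close> is the one for which \<open>0\<close> becomes a root.\<close>

subsection \<open>Hankel matrices as bilinear forms on polynomials\<close>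

text \<open>The moments of w are not those of the representing measure \<mu> but of x^(-2 k1)
  d\<mu>. This density is positive off 0, so the negative exponents leave a single trace: 0 must not
  be a node. The rank equalities in (4) enter through a count. Taking the columns in ascending
  order, the rank of a Hankel matrix counts the degrees that no kernel polynomial has; in descending
  order it counts the vanishing orders at 0 that none has. For a positive semidefinite form the
  kernel consists of the isotropic polynomials, so compressing the form to a subspace just restricts
  the kernel. Hence equality with the rank of M(-k1,k2-1) says that some kernel polynomial has
  degree exactly n, and equality with that of M(-k1+1,k2) that some kernel polynomial has a nonzero
  constant term. The obstacle is that the functional is known only up to degree 2n, so the kernel is
  not visibly closed under multiplication by x: positivity yields closure only up to degree n - 1,
  and the kernel polynomial of degree n supplies the last step. If a measure is given, it replaces
  this argument, since vanishing almost everywhere passes to all multiples.\<close>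

definition riesz :: "(nat \<Rightarrow> real) \<Rightarrow> real poly \<Rightarrow> real" where
  "riesz w f = (\<Sum>i\<le>degree f. coeff f i * w i)"

text \<open>Bounding the support of the coefficients, not \<open>degree\<close>, makes this a
  subspace for every s: it contains 0, and for s = 0 it is {0}.\<close>

definition polys_below :: "nat \<Rightarrow> real poly set" where
  "polys_below s = {p. \<forall>i\<ge>s. coeff p i = 0}"

text \<open>The offset \<open>a\<close> twists the form by x^a. For \<open>a = 2\<close> this is
  L((x p)(x q)), the form restricted to multiples of x.\<close>

definition hank_kernel :: "(nat \<Rightarrow> real) \<Rightarrow> nat \<Rightarrow> nat \<Rightarrow> real poly set" where
  "hank_kernel w a s = {p \<in> polys_below s. \<forall>i<s. riesz w (monom 1 (a + i) * p) = 0}"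

lemma riesz_eq_sum:
  assumes "finite I" "\<And>i. i \<notin> I \<Longrightarrow> coeff f i = 0"
  shows "riesz w f = (\<Sum>i\<in>I. coeff f i * w i)"
proof -
  have "riesz w f = (\<Sum>i\<in>{i. coeff f i \<noteq> 0}. coeff f i * w i)"
    unfolding riesz_def
    by (intro sum.mono_neutral_right) (auto simp: le_degree)
  also have "\<dots> = (\<Sum>i\<in>I. coeff f i * w i)"
    using assms by (intro sum.mono_neutral_left) auto
  finally show ?thesis .
qed

lemma riesz_add: "riesz w (f + g) = riesz w f + riesz w g"
proof -
  let ?I = "{..max (degree f) (degree g)}"
  have "riesz w (f + g) = (\<Sum>i\<in>?I. coeff (f + g) i * w i)"
    by (intro riesz_eq_sum) (auto simp: coeff_eq_0)
  moreover have "riesz w f = (\<Sum>i\<in>?I. coeff f i * w i)" "riesz w g = (\<Sum>i\<in>?I. coeff g i * w i)"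
    by (intro riesz_eq_sum; auto simp: coeff_eq_0)+
  ultimately show ?thesis by (simp add: algebra_simps sum.distrib)
qed

lemma riesz_smult [simp]: "riesz w (Polynomial.smult c f) = c * riesz w f"
proof -
  have "riesz w (Polynomial.smult c f) = (\<Sum>i\<le>degree f. coeff (Polynomial.smult c f) i * w i)"
    by (intro riesz_eq_sum) (auto simp: coeff_eq_0)
  then show ?thesis by (simp add: riesz_def sum_distrib_left mult.assoc)
qed

lemma riesz_0 [simp]: "riesz w 0 = 0"
  by (simp add: riesz_def)

lemma riesz_minus: "riesz w (- f) = - riesz w f"
  using riesz_smult[of w "-1" f] by simp

lemma riesz_diff: "riesz w (f - g) = riesz w f - riesz w g"
  using riesz_add[of w f "- g"] by (simp add: riesz_minus)

lemma riesz_sum: "riesz w (\<Sum>i\<in>I. f i) = (\<Sum>i\<in>I. riesz w (f i))"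
  by (induction I rule: infinite_finite_induct) (auto simp: riesz_add)

lemma riesz_monom: "riesz w (monom c k) = c * w k"
  by (subst riesz_eq_sum[where I = "{k}"]) auto

lemma riesz_monom_mult_sum:
  assumes "finite I" "\<And>i. i \<notin> I \<Longrightarrow> coeff p i = 0"
  shows "riesz w (monom 1 k * p) = (\<Sum>i\<in>I. coeff p i * w (k + i))"
proof -
  have "riesz w (monom 1 k * p) = (\<Sum>i\<in>(+) k ` I. coeff (monom 1 k * p) i * w i)"
    using assms
    by (intro riesz_eq_sum) (force simp: coeff_monom_mult image_iff dest: le_Suc_ex)+
  also have "\<dots> = (\<Sum>i\<in>I. coeff p i * w (k + i))"
    by (subst sum.reindex) (auto simp: coeff_monom_mult)
  finally show ?thesis .
qed

lemma riesz_mult_sum: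
  assumes "finite I" "\<And>i. i \<notin> I \<Longrightarrow> coeff p i = 0"
  shows "riesz w (p * q) = (\<Sum>i\<in>I. coeff p i * riesz w (monom 1 i * q))"
proof -
  have "p = (\<Sum>i\<in>I. monom (coeff p i) i)"
    using assms by (intro poly_eqI) (auto simp: coeff_sum)
  then have "riesz w (p * q) = riesz w ((\<Sum>i\<in>I. monom (coeff p i) i) * q)"
    by simp
  also have "(\<Sum>i\<in>I. monom (coeff p i) i) * q
      = (\<Sum>i\<in>I. Polynomial.smult (coeff p i) (monom 1 i * q))"
    by (simp add: sum_distrib_right smult_monom flip: mult_smult_left)
  finally show ?thesis by (simp add: riesz_sum)
qed

lemma riesz_mult_eq_0:
  assumes "\<And>i. i \<le> d \<Longrightarrow> riesz w (monom 1 i * q) = 0" "p \<in> polys_below (Suc d)"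
  shows "riesz w (p * q) = 0"
  using assms by (subst riesz_mult_sum[where I = "{..d}"]) (auto simp: polys_below_def)

lemma polys_below_iff: "p \<in> polys_below s \<longleftrightarrow> p = 0 \<or> degree p < s"
proof -
  have "degree p < s" if "p \<in> polys_below s" "p \<noteq> 0"
  proof (rule ccontr)
    assume "\<not> degree p < s"
    then have "lead_coeff p = 0" using that(1) by (auto simp: polys_below_def)
    with that(2) show False by simp
  qed
  then show ?thesis by (auto simp: polys_below_def coeff_eq_0)
qed

lemma polys_below_Suc_iff: "p \<in> polys_below (Suc s) \<longleftrightarrow> degree p \<le> s"
  by (auto simp: polys_below_iff)

lemma polys_below_0 [simp]: "p \<in> polys_below 0 \<longleftrightarrow> p = 0"
  by (simp add: polys_below_iff)

lemma polys_below_add: "p \<in> polys_below s \<Longrightarrow> q \<in> polys_below s \<Longrightarrow> p + q \<in> polys_below s"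
  and polys_below_diff: "p \<in> polys_below s \<Longrightarrow> q \<in> polys_below s \<Longrightarrow> p - q \<in> polys_below s"
  and polys_below_smult: "p \<in> polys_below s \<Longrightarrow> Polynomial.smult c p \<in> polys_below s"
  and polys_below_mono: "p \<in> polys_below s \<Longrightarrow> s \<le> t \<Longrightarrow> p \<in> polys_below t"
  and zero_in_polys_below: "0 \<in> polys_below s"
  and monom_in_polys_below: "i < s \<Longrightarrow> monom c i \<in> polys_below s"
  by (auto simp: polys_below_def)

lemma polys_below_monom_mult:
  "p \<in> polys_below s \<Longrightarrow> monom 1 k * p \<in> polys_below (k + s)"
  by (auto simp: polys_below_def coeff_monom_mult)

lemma polys_below_mult:
  assumes "p \<in> polys_below (Suc s)" "q \<in> polys_below t"
  shows "p * q \<in> polys_below (s + t)"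
  using assms degree_mult_le[of p q] by (auto simp: polys_below_iff)

lemma vec_coeff_surj:
  assumes "v \<in> carrier_vec s"
  obtains p where "p \<in> polys_below s" "v = vec s (coeff p)"
proof
  let ?p = "\<Sum>i<s. monom (v $ i) i"
  show "?p \<in> polys_below s" by (auto simp: polys_below_def coeff_sum)
  show "v = vec s (coeff ?p)" using assms by (intro eq_vecI) (auto simp: coeff_sum)
qed

lemma vec_coeff_eq_0_iff:
  "p \<in> polys_below s \<Longrightarrow> vec s (coeff p) = 0\<^sub>v s \<longleftrightarrow> p = 0"
  by (auto simp: polys_below_def poly_eq_iff vec_eq_iff) (metis not_le)

lemma hank_carrier [simp]: "hank w a s \<in> carrier_mat s s"
  and dim_row_hank [simp]: "dim_row (hank w a s) = s"
  and dim_col_hank [simp]: "dim_col (hank w a s) = s"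
  by (auto simp: hank_def)

lemma hank_mult_vec:
  assumes "p \<in> polys_below s"
  shows "hank w a s *\<^sub>v vec s (coeff p) = vec s (\<lambda>i. riesz w (monom 1 (a + i) * p))"
proof (intro eq_vecI)
  fix i assume "i < dim_vec (vec s (\<lambda>i. riesz w (monom 1 (a + i) * p)))"
  then have i: "i < s" by simp
  have "riesz w (monom 1 (a + i) * p) = (\<Sum>j<s. coeff p j * w (a + i + j))"
    using assms by (intro riesz_monom_mult_sum) (auto simp: polys_below_def)
  with i show "(hank w a s *\<^sub>v vec s (coeff p)) $ i = vec s (\<lambda>i. riesz w (monom 1 (a + i) * p)) $ i"
    by (simp add: hank_def scalar_prod_def atLeast0LessThan mult.commute)
qed (simp add: hank_def)

text \<open>\<open>hank w a s\<close> is the Gram matrix of 1, x, ..., x^(s-1) for the form L(x^a p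
  q). All definiteness statements are read through this identity.\<close>

lemma hank_bilinear:
  assumes "p \<in> polys_below s" "q \<in> polys_below s"
  shows "vec s (coeff p) \<bullet> (hank w a s *\<^sub>v vec s (coeff q)) = riesz w (monom 1 a * (p * q))"
proof -
  have "riesz w (monom 1 a * (p * q)) = riesz w (p * (monom 1 a * q))"
    by (simp add: mult_ac)
  also have "\<dots> = (\<Sum>i<s. coeff p i * riesz w (monom 1 i * (monom 1 a * q)))"
    using assms by (intro riesz_mult_sum) (auto simp: polys_below_def)
  also have "\<dots> = (\<Sum>i<s. coeff p i * riesz w (monom 1 (a + i) * q))"
    by (simp add: mult_monom add.commute flip: mult.assoc)
  also have "\<dots> = vec s (coeff p) \<bullet> (hank w a s *\<^sub>v vec s (coeff q))"
    unfolding hank_mult_vec[OF assms(2)] by (simp add: scalar_prod_def atLeast0LessThan)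
  finally show ?thesis by simp
qed

lemma psd_hank_iff:
  "psd_mat (hank w a s) \<longleftrightarrow> (\<forall>p\<in>polys_below s. riesz w (monom 1 a * (p * p)) \<ge> 0)"
proof
  assume psd: "psd_mat (hank w a s)"
  then show "\<forall>p\<in>polys_below s. riesz w (monom 1 a * (p * p)) \<ge> 0"
    by (auto simp: psd_mat_def simp flip: hank_bilinear)
next
  assume *: "\<forall>p\<in>polys_below s. riesz w (monom 1 a * (p * p)) \<ge> 0"
  show "psd_mat (hank w a s)"
    unfolding psd_mat_def
  proof (intro conjI ballI)
    fix v :: "real vec" assume "v \<in> carrier_vec (dim_row (hank w a s))"
    then obtain p where "p \<in> polys_below s" "v = vec s (coeff p)"
      by (auto elim: vec_coeff_surj)
    with * show "0 \<le> v \<bullet> (hank w a s *\<^sub>v v)" by (simp add: hank_bilinear)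
  qed simp
qed

lemma pd_hank_iff:
  "pd_mat (hank w a s) \<longleftrightarrow> (\<forall>p\<in>polys_below s. p \<noteq> 0 \<longrightarrow> riesz w (monom 1 a * (p * p)) > 0)"
proof
  assume pd: "pd_mat (hank w a s)"
  show "\<forall>p\<in>polys_below s. p \<noteq> 0 \<longrightarrow> riesz w (monom 1 a * (p * p)) > 0"
  proof (intro ballI impI)
    fix p assume p: "p \<in> polys_below s" "p \<noteq> 0"
    then have "vec s (coeff p) \<bullet> (hank w a s *\<^sub>v vec s (coeff p)) > 0"
      using pd by (auto simp: pd_mat_def vec_coeff_eq_0_iff)
    then show "riesz w (monom 1 a * (p * p)) > 0" using p by (simp add: hank_bilinear)
  qed
next
  assume *: "\<forall>p\<in>polys_below s. p \<noteq> 0 \<longrightarrow> riesz w (monom 1 a * (p * p)) > 0"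
  show "pd_mat (hank w a s)"
    unfolding pd_mat_def
  proof (intro conjI ballI impI)
    fix v :: "real vec" assume "v \<in> carrier_vec (dim_row (hank w a s))" "v \<noteq> 0\<^sub>v (dim_row (hank w a s))"
    moreover from this obtain p where p: "p \<in> polys_below s" "v = vec s (coeff p)"
      by (auto elim: vec_coeff_surj)
    ultimately show "0 < v \<bullet> (hank w a s *\<^sub>v v)"
      using * by (auto simp: hank_bilinear vec_coeff_eq_0_iff)
  qed simp
qed

lemma hank_kernel_iff:
  assumes "p \<in> polys_below s"
  shows "p \<in> hank_kernel w a s \<longleftrightarrow> hank w a s *\<^sub>v vec s (coeff p) = 0\<^sub>v s"
  using assms by (auto simp: hank_mult_vec hank_kernel_def vec_eq_iff)

lemma det_hank_eq_0_iff: "det (hank w a s) = 0 \<longleftrightarrow> (\<exists>p\<in>hank_kernel w a s. p \<noteq> 0)"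
proof
  assume "det (hank w a s) = 0"
  then obtain v where "v \<in> carrier_vec s" "v \<noteq> 0\<^sub>v s" "hank w a s *\<^sub>v v = 0\<^sub>v s"
    using det_0_iff_vec_prod_zero_field[OF hank_carrier] by blast
  then show "\<exists>p\<in>hank_kernel w a s. p \<noteq> 0"
    by (metis vec_coeff_surj hank_kernel_iff vec_coeff_eq_0_iff)
next
  assume "\<exists>p\<in>hank_kernel w a s. p \<noteq> 0"
  then obtain p where p: "p \<in> hank_kernel w a s" "p \<noteq> 0" by blast
  then have "p \<in> polys_below s" by (simp add: hank_kernel_def)
  with p show "det (hank w a s) = 0"
    using det_0_iff_vec_prod_zero_field[OF hank_carrier, of w a s]
    by (metis hank_kernel_iff vec_coeff_eq_0_iff vec_carrier)
qed

lemma hank_kernel_smult: "p \<in> hank_kernel w a s \<Longrightarrow> Polynomial.smult c p \<in> hank_kernel w a s"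
  by (auto simp: hank_kernel_def polys_below_smult)

lemma hank_kernel_add:
  "p \<in> hank_kernel w a s \<Longrightarrow> q \<in> hank_kernel w a s \<Longrightarrow> p + q \<in> hank_kernel w a s"
  by (auto simp: hank_kernel_def polys_below_add riesz_add distrib_left)

lemma hank_kernel_diff:
  "p \<in> hank_kernel w a s \<Longrightarrow> q \<in> hank_kernel w a s \<Longrightarrow> p - q \<in> hank_kernel w a s"
  by (auto simp: hank_kernel_def polys_below_diff riesz_diff right_diff_distrib)

section \<open>Inverse matrices as solutions of linear systems\<close>

lemma pd_mat_det_nonzero:
  assumes "A \<in> carrier_mat s s" "pd_mat A"
  shows "det A \<noteq> 0"
proof
  assume "det A = 0"
  then obtain v where "v \<in> carrier_vec s" "v \<noteq> 0\<^sub>v s" "A *\<^sub>v v = 0\<^sub>v s"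
    using det_0_iff_vec_prod_zero_field[OF assms(1)] by blast
  with assms show False by (auto simp: pd_mat_def)
qed

text \<open>\<open>inv_mat\<close> is \<open>the\<close> of an option; a nonzero determinant makes
  the matrix a unit and so guarantees the case \<open>Some\<close>.\<close>

lemma inv_mat:
  assumes "A \<in> carrier_mat s s" "det A \<noteq> 0"
  shows "inv_mat A \<in> carrier_mat s s" "inv_mat A * A = 1\<^sub>m s" "A * inv_mat A = 1\<^sub>m s"
proof -
  obtain B where "mat_inverse A = Some B"
    using mat_inverse(1)[OF assms(1)] det_non_zero_imp_unit[OF assms] by fastforce
  with mat_inverse(2)[OF assms(1), of B]
  show "inv_mat A \<in> carrier_mat s s" "inv_mat A * A = 1\<^sub>m s" "A * inv_mat A = 1\<^sub>m s"
    by (auto simp: inv_mat_def)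
qed

text \<open>Through this equivalence \<phi>, \<psi> and the products with an inverse in part (ii)
  become systems with a Hankel matrix, that is, orthogonality relations for polynomials.\<close>

lemma inv_mat_mult_vec_eq_iff:
  assumes "A \<in> carrier_mat s s" "det A \<noteq> 0" "x \<in> carrier_vec s" "b \<in> carrier_vec s"
  shows "inv_mat A *\<^sub>v b = x \<longleftrightarrow> A *\<^sub>v x = b"
proof
  note inv = inv_mat[OF assms(1,2)]
  show "A *\<^sub>v x = b" if "inv_mat A *\<^sub>v b = x"
    using assoc_mult_mat_vec[OF assms(1) inv(1) assms(4)] inv(3) assms(4) that by simp
  show "inv_mat A *\<^sub>v b = x" if "A *\<^sub>v x = b"
    using assoc_mult_mat_vec[OF inv(1) assms(1,3)] inv(2) assms(3) that by simp
qed

subsection \<open>Rank and kernel of Hankel matrices\<close>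

text \<open>Greedy choice of a basis: an entry is kept exactly when it lies outside the span of its
  predecessors. The order of the list is free, and two different orders are used later.\<close>

lemma (in vec_space) dim_span_list:
  assumes "set xs \<subseteq> carrier_vec n"
  shows "vectorspace.dim class_ring (span_vs (set xs)) =
         card {j. j < length xs \<and> xs ! j \<notin> span (set (take j xs))}"
proof -
  have "\<exists>U \<subseteq> set xs. lin_indpt U \<and> set xs \<subseteq> span U \<and>
          card U = card {j. j < length xs \<and> xs ! j \<notin> span (set (take j xs))}"
    using assms
  proof (induction xs rule: rev_induct)
    case Nil
    show ?case by (intro exI[of _ "{}"]) (auto simp: lin_dep_def)
  next
    case (snoc x xs)
    let ?P = "\<lambda>xs. {j. j < length xs \<and> xs ! j \<notin> span (set (take j xs))}"
    from snoc obtain U where U: "U \<subseteq> set xs" "lin_indpt U" "set xs \<subseteq> span U" "card U = card (?P xs)"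
      by auto
    have x: "x \<in> carrier_vec n" and xs: "set xs \<subseteq> carrier_vec n" using snoc by auto
    then have Uc: "U \<subseteq> carrier_vec n" using U by blast
    have span_eq: "span (set xs) = span U"
      using U xs Uc span_subsetI[OF Uc U(3)] span_is_monotone[OF U(1)] by blast
    have P: "?P (xs @ [x]) = ?P xs \<union> (if x \<in> span (set xs) then {} else {length xs})"
      by (auto simp: nth_append less_Suc_eq)
    show ?case
    proof (cases "x \<in> span (set xs)")
      case True
      with U P span_eq show ?thesis by (intro exI[of _ U]) auto
    next
      case False
      then have "x \<notin> span U" using span_eq by simp
      then have xU: "x \<notin> U" using span_mem[OF Uc] by blast
      have "lin_indpt (insert x U)"
        using lin_dep_iff_in_span[OF Uc U(2) x xU] \<open>x \<notin> span U\<close> by simp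
      moreover have "set (xs @ [x]) \<subseteq> span (insert x U)"
        using subset_trans[OF U(3) span_is_monotone[of U "insert x U"]]
          in_own_span[of "insert x U"] Uc x by auto
      moreover have "card (insert x U) = card (?P (xs @ [x]))"
        using xU False U(1,4) finite_subset[OF U(1)] unfolding P by (subst card_Un_disjoint) auto
      ultimately show ?thesis using U(1) by (intro exI[of _ "insert x U"]) auto
    qed
  qed
  then obtain U where U: "U \<subseteq> set xs" "lin_indpt U" "set xs \<subseteq> span U"
      "card U = card {j. j < length xs \<and> xs ! j \<notin> span (set (take j xs))}" by blast
  have Uc: "U \<subseteq> carrier_vec n" using U(1) assms by blast
  \<comment> \<open>The dimension formula for a span asks for a maximal independent subset; U is one
    because every entry already lies in \<open>span U\<close>.\<close>
  have max: "maximal U (\<lambda>T. T \<subseteq> set xs \<and> lin_indpt T)"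
    unfolding maximal_def
  proof (intro conjI allI impI)
    fix T assume T: "U \<subseteq> T \<and> T \<subseteq> set xs \<and> lin_indpt T"
    show "T = U"
    proof (rule ccontr)
      assume "T \<noteq> U"
      with T obtain t where t: "t \<in> T" "t \<notin> U" by blast
      then have "t \<in> span U" "t \<in> carrier_vec n" using U(3) T assms by auto
      then have "lin_dep (insert t U)"
        using lin_dep_iff_in_span[OF Uc U(2) _ t(2)] by simp
      moreover have "insert t U \<subseteq> T" using T t by blast
      ultimately show False using T subset_li_is_li by blast
    qed
  qed (use U in auto)
  show ?thesis using dim_span[OF assms _ max] U(4) by simp
qed

text \<open>The coefficients are indexed by K and not by the image of f, since two columns with
  different indices may be equal. A distinct enumeration of K translates list combinations into sums
  over K.\<close>

lemma (in vec_space) in_span_image_iff: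
  assumes K: "finite K" "f ` K \<subseteq> carrier_vec n" and x: "x \<in> carrier_vec n"
  shows "x \<in> span (f ` K) \<longleftrightarrow> (\<exists>c. \<forall>i<n. x $ i = (\<Sum>k\<in>K. c k * f k $ i))"
proof -
  obtain ks where ks: "distinct ks" "set ks = K"
    using finite_distinct_list[OF K(1)] by blast
  have bij: "bij_betw ((!) ks) {..<length ks} K"
    using bij_betw_nth ks by blast
  have dims: "\<forall>w\<in>set (map f ks). dim_vec w = n" using K ks by auto
  have "x \<in> span (f ` K) \<longleftrightarrow> x \<in> span_list (map f ks)"
    using span_list_as_span[of "map f ks"] K ks by simp
  also have "\<dots> \<longleftrightarrow> (\<exists>c. x = lincomb_list c (map f ks))"
    by (auto simp: span_list_def)
  also have "\<dots> \<longleftrightarrow> (\<exists>c. \<forall>i<n. x $ i = (\<Sum>l<length ks. c l * f (ks ! l) $ i))"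
  proof (intro ex_cong1)
    fix c
    have "lincomb_list c (map f ks) $ i = (\<Sum>l<length ks. c l * f (ks ! l) $ i)" if "i < n" for i
      unfolding lincomb_list_as_mat_mult[OF dims] using that
      by (simp add: scalar_prod_def mat_of_cols_def atLeast0LessThan mult.commute)
    moreover have "dim_vec (lincomb_list c (map f ks)) = n"
      unfolding lincomb_list_as_mat_mult[OF dims] by simp
    ultimately show "x = lincomb_list c (map f ks) \<longleftrightarrow>
        (\<forall>i<n. x $ i = (\<Sum>l<length ks. c l * f (ks ! l) $ i))"
      using x by (auto simp: vec_eq_iff)
  qed
  also have "\<dots> \<longleftrightarrow> (\<exists>c. \<forall>i<n. x $ i = (\<Sum>k\<in>K. c k * f k $ i))"
  proof
    assume "\<exists>c. \<forall>i<n. x $ i = (\<Sum>l<length ks. c l * f (ks ! l) $ i)"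
    then obtain c where c: "\<forall>i<n. x $ i = (\<Sum>l<length ks. c l * f (ks ! l) $ i)" by blast
    let ?c = "\<lambda>k. c (inv_into {..<length ks} ((!) ks) k)"
    have "(\<Sum>k\<in>K. ?c k * f k $ i) = (\<Sum>l<length ks. c l * f (ks ! l) $ i)" for i
      using bij by (subst sum.reindex_bij_betw[OF bij, symmetric])
        (auto intro!: sum.cong simp: inv_into_f_f[OF bij_betw_imp_inj_on[OF bij]])
    with c show "\<exists>c. \<forall>i<n. x $ i = (\<Sum>k\<in>K. c k * f k $ i)" by (intro exI[of _ ?c]) simp
  next
    assume "\<exists>c. \<forall>i<n. x $ i = (\<Sum>k\<in>K. c k * f k $ i)"
    then obtain c where c: "\<forall>i<n. x $ i = (\<Sum>k\<in>K. c k * f k $ i)" by blast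
    then show "\<exists>c. \<forall>i<n. x $ i = (\<Sum>l<length ks. c l * f (ks ! l) $ i)"
      by (intro exI[of _ "\<lambda>l. c (ks ! l)"]) (simp add: sum.reindex_bij_betw[OF bij, symmetric])
  qed
  finally show ?thesis .
qed

text \<open>The columns may be visited in any order \<open>js\<close>. Ascending order will detect
  degrees of kernel polynomials, descending order their vanishing orders at 0.\<close>

lemma mat_rank_eq_card:
  fixes A :: "real mat"
  assumes A: "A \<in> carrier_mat m s" and js: "mset js = mset [0..<s]"
  shows "mat_rank A = card {j. j < s \<and>
    \<not> (\<exists>c. \<forall>i<m. A $$ (i, js ! j) = (\<Sum>k\<in>set (take j js). c k * A $$ (i, k)))}"
proof -
  interpret vec_space "TYPE(real)" m .
  have set_js: "set js = {..<s}"
    using mset_eq_setD[OF js] by (simp add: atLeast0LessThan)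
  have len: "length js = s"
    using mset_eq_length[OF js] by simp
  let ?vs = "map (col A) js"
  have "set (cols A) = col A ` {..<s}"
    using A by (auto simp: cols_def)
  then have vs: "set ?vs = set (cols A)" using set_js by simp
  have c: "set ?vs \<subseteq> carrier_vec m"
    using A col_dim[of A] by auto
  have "mat_rank A = vectorspace.dim class_ring (span_vs (set ?vs))"
    by (simp only: mat_rank_def rank_def vs carrier_matD(1)[OF A])
  also have "\<dots> = card {j. j < length ?vs \<and> ?vs ! j \<notin> span (set (take j ?vs))}"
    by (rule dim_span_list[OF c])
  also have "{j. j < length ?vs \<and> ?vs ! j \<notin> span (set (take j ?vs))} = {j. j < s \<and>
      \<not> (\<exists>c. \<forall>i<m. A $$ (i, js ! j) = (\<Sum>k\<in>set (take j js). c k * A $$ (i, k)))}"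
  proof (intro Collect_cong conj_cong)
    fix j assume "j < s"
    then have j: "js ! j < s" using set_js len nth_mem by fastforce
    have *: "set (take j js) \<subseteq> {..<s}" using set_js set_take_subset by metis
    then have "col A ` set (take j js) \<subseteq> carrier_vec m"
      using A col_dim[of A] by auto
    moreover have "col A (js ! j) \<in> carrier_vec m" using A col_dim[of A] by auto
    ultimately have "col A (js ! j) \<in> span (col A ` set (take j js)) \<longleftrightarrow>
        (\<exists>c. \<forall>i<m. col A (js ! j) $ i = (\<Sum>k\<in>set (take j js). c k * col A k $ i))"
      by (intro in_span_image_iff) auto
    also have "\<dots> \<longleftrightarrow> (\<exists>c. \<forall>i<m. A $$ (i, js ! j) = (\<Sum>k\<in>set (take j js). c k * A $$ (i, k)))"
    proof (intro ex_cong1 all_cong1 imp_cong refl)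
      fix c i assume "i < m"
      have "(\<Sum>k\<in>set (take j js). c k * col A k $ i) = (\<Sum>k\<in>set (take j js). c k * A $$ (i, k))"
        using * A \<open>i < m\<close> by (intro sum.cong) auto
      with j A \<open>i < m\<close> show "(col A (js ! j) $ i = (\<Sum>k\<in>set (take j js). c k * col A k $ i)) \<longleftrightarrow>
          (A $$ (i, js ! j) = (\<Sum>k\<in>set (take j js). c k * A $$ (i, k)))" by simp
    qed
    finally show "?vs ! j \<notin> span (set (take j ?vs)) \<longleftrightarrow>
      \<not> (\<exists>c. \<forall>i<m. A $$ (i, js ! j) = (\<Sum>k\<in>set (take j js). c k * A $$ (i, k)))"
      using \<open>j < s\<close> len by (simp add: take_map)
  qed (use len in simp)
  finally show ?thesis .
qed

text \<open>A relation expressing column j through the columns in K is the polynomial x^j - (sum of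
  c_k x^k over K) in the kernel; conversely a kernel polynomial is divided by its coefficient at
  j.\<close>

lemma hank_column_dependent_iff:
  assumes "finite K" "K \<subseteq> {..<s}" "j < s" "j \<notin> K"
  shows "(\<exists>c. \<forall>i<s. hank w a s $$ (i, j) = (\<Sum>k\<in>K. c k * hank w a s $$ (i, k))) \<longleftrightarrow>
         (\<exists>p\<in>hank_kernel w a s. coeff p j \<noteq> 0 \<and> (\<forall>i. i \<notin> insert j K \<longrightarrow> coeff p i = 0))"
proof -
  have entry: "hank w a s $$ (i, k) = w (a + i + k)" if "i < s" "k < s" for i k
    using that by (simp add: hank_def)
  have sum: "(\<Sum>k\<in>K. c k * hank w a s $$ (i, k)) = (\<Sum>k\<in>K. c k * w (a + i + k))" if "i < s" for c i
    using that assms by (intro sum.cong) (auto simp: entry)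
  show ?thesis
  proof
    assume "\<exists>c. \<forall>i<s. hank w a s $$ (i, j) = (\<Sum>k\<in>K. c k * hank w a s $$ (i, k))"
    then obtain c where c: "\<And>i. i < s \<Longrightarrow> w (a + i + j) = (\<Sum>k\<in>K. c k * w (a + i + k))"
      using assms(3) by (auto simp: sum entry)
    define p where "p = monom 1 j - (\<Sum>k\<in>K. monom (c k) k)"
    have coeff: "coeff p i = (if i = j then 1 else 0) - (if i \<in> K then c i else 0)" for i
      using assms(1) by (auto simp: p_def coeff_sum)
    have "riesz w (monom 1 (a + i) * p) = 0" if "i < s" for i
      using c[OF that]
      by (simp add: p_def right_diff_distrib sum_distrib_left mult_monom riesz_diff riesz_sum riesz_monom)
    then have "p \<in> hank_kernel w a s"
      using assms(2,3) by (auto simp: hank_kernel_def polys_below_def coeff)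
    then show "\<exists>p\<in>hank_kernel w a s. coeff p j \<noteq> 0 \<and> (\<forall>i. i \<notin> insert j K \<longrightarrow> coeff p i = 0)"
      using assms(4) by (intro bexI[of _ p]) (auto simp: coeff)
  next
    assume "\<exists>p\<in>hank_kernel w a s. coeff p j \<noteq> 0 \<and> (\<forall>i. i \<notin> insert j K \<longrightarrow> coeff p i = 0)"
    then obtain p where p: "p \<in> hank_kernel w a s" "coeff p j \<noteq> 0" "\<And>i. i \<notin> insert j K \<Longrightarrow> coeff p i = 0"
      by blast
    have "w (a + i + j) = (\<Sum>k\<in>K. (- coeff p k / coeff p j) * w (a + i + k))" if "i < s" for i
    proof -
      have "0 = riesz w (monom 1 (a + i) * p)" using p(1) that by (simp add: hank_kernel_def)
      also have "\<dots> = (\<Sum>k\<in>insert j K. coeff p k * w (a + i + k))"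
        using p(3) assms(1) by (intro riesz_monom_mult_sum) auto
      also have "\<dots> = coeff p j * w (a + i + j) + (\<Sum>k\<in>K. coeff p k * w (a + i + k))"
        using assms(1,4) by simp
      finally have "coeff p j * w (a + i + j) = - (\<Sum>k\<in>K. coeff p k * w (a + i + k))" by simp
      then have "w (a + i + j) = - (\<Sum>k\<in>K. coeff p k * w (a + i + k)) / coeff p j"
        using p(2) by (simp add: field_simps)
      then show ?thesis by (simp add: sum_divide_distrib sum_negf)
    qed
    then show "\<exists>c. \<forall>i<s. hank w a s $$ (i, j) = (\<Sum>k\<in>K. c k * hank w a s $$ (i, k))"
      using assms(3) by (intro exI[of _ "\<lambda>k. - coeff p k / coeff p j"] allI impI) (simp only: sum entry)
  qed
qed

lemma degree_eq_iff_coeff: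
  "coeff p j \<noteq> 0 \<and> (\<forall>i. i \<notin> insert j {..<j} \<longrightarrow> coeff p i = 0) \<longleftrightarrow> p \<noteq> 0 \<and> degree p = j"
  by (auto simp: coeff_eq_0 le_antisym le_degree degree_le)

text \<open>In ascending order the predecessors of column j are the columns below j, so a dependence
  at j is a kernel polynomial with leading term at j.\<close>

lemma mat_rank_hank_degree:
  "mat_rank (hank w a s) = card {j. j < s \<and> \<not> (\<exists>p\<in>hank_kernel w a s. p \<noteq> 0 \<and> degree p = j)}"
proof -
  have "mat_rank (hank w a s) = card {j. j < s \<and> \<not> (\<exists>c. \<forall>i<s. hank w a s $$ (i, [0..<s] ! j) =
      (\<Sum>k\<in>set (take j [0..<s]). c k * hank w a s $$ (i, k)))}"
    by (rule mat_rank_eq_card) auto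
  also have "{j. j < s \<and> \<not> (\<exists>c. \<forall>i<s. hank w a s $$ (i, [0..<s] ! j) =
      (\<Sum>k\<in>set (take j [0..<s]). c k * hank w a s $$ (i, k)))} =
      {j. j < s \<and> \<not> (\<exists>p\<in>hank_kernel w a s. p \<noteq> 0 \<and> degree p = j)}"
  proof (intro Collect_cong conj_cong refl arg_cong[where f = Not])
    fix j assume j: "j < s"
    then have "set (take j [0..<s]) = {..<j}" by auto
    then show "(\<exists>c. \<forall>i<s. hank w a s $$ (i, [0..<s] ! j) =
        (\<Sum>k\<in>set (take j [0..<s]). c k * hank w a s $$ (i, k))) \<longleftrightarrow>
        (\<exists>p\<in>hank_kernel w a s. p \<noteq> 0 \<and> degree p = j)"
      using hank_column_dependent_iff[of "{..<j}" s j w a] j unfolding degree_eq_iff_coeff by simp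
  qed
  finally show ?thesis .
qed

text \<open>In descending order the predecessors of column j are the columns above j, so a
  dependence at j is a kernel polynomial whose lowest term sits at j.\<close>

lemma mat_rank_hank_order:
  "mat_rank (hank w a s) = card {j. j < s \<and>
     \<not> (\<exists>p\<in>hank_kernel w a s. coeff p j \<noteq> 0 \<and> (\<forall>i<j. coeff p i = 0))}"
proof -
  let ?js = "rev [0..<s]"
  let ?R = "\<lambda>j. \<exists>p\<in>hank_kernel w a s. coeff p j \<noteq> 0 \<and> (\<forall>i<j. coeff p i = 0)"
  have "mat_rank (hank w a s) = card {j. j < s \<and> \<not> (\<exists>c. \<forall>i<s. hank w a s $$ (i, ?js ! j) =
      (\<Sum>k\<in>set (take j ?js). c k * hank w a s $$ (i, k)))}"
    by (rule mat_rank_eq_card) auto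
  also have "{j. j < s \<and> \<not> (\<exists>c. \<forall>i<s. hank w a s $$ (i, ?js ! j) =
      (\<Sum>k\<in>set (take j ?js). c k * hank w a s $$ (i, k)))} = {j. j < s \<and> \<not> ?R (s - 1 - j)}"
  proof (intro Collect_cong conj_cong refl arg_cong[where f = Not])
    fix j assume j: "j < s"
    have set: "set (take j ?js) = {s - j..<s}" using j by (simp add: take_rev)
    have nth: "?js ! j = s - 1 - j" using j by (simp add: rev_nth)
    have "(\<exists>p\<in>hank_kernel w a s. coeff p (s - 1 - j) \<noteq> 0 \<and>
        (\<forall>i. i \<notin> insert (s - 1 - j) {s - j..<s} \<longrightarrow> coeff p i = 0)) \<longleftrightarrow> ?R (s - 1 - j)"
    proof (intro bex_cong conj_cong refl)
      fix p assume "p \<in> hank_kernel w a s"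
      then have "\<forall>i\<ge>s. coeff p i = 0" by (simp add: hank_kernel_def polys_below_def)
      moreover have "insert (s - 1 - j) {s - j..<s} = {s - 1 - j..<s}" using j by auto
      ultimately show "(\<forall>i. i \<notin> insert (s - 1 - j) {s - j..<s} \<longrightarrow> coeff p i = 0) \<longleftrightarrow>
          (\<forall>i<s - 1 - j. coeff p i = 0)"
        using j by (auto simp: not_le)
    qed
    moreover have "{s - j..<s} \<subseteq> {..<s}" "s - 1 - j < s" "s - 1 - j \<notin> {s - j..<s}"
      using j by auto
    ultimately show "(\<exists>c. \<forall>i<s. hank w a s $$ (i, ?js ! j) =
        (\<Sum>k\<in>set (take j ?js). c k * hank w a s $$ (i, k))) \<longleftrightarrow> ?R (s - 1 - j)"
      unfolding set nth
      by (subst hank_column_dependent_iff) simp_all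
  qed
  \<comment> \<open>Position j of the reversed list is column s - 1 - j; the reflection preserves
    the count.\<close>
  also have "card {j. j < s \<and> \<not> ?R (s - 1 - j)} = card {j. j < s \<and> \<not> ?R j}"
    by (rule bij_betw_same_card[of "\<lambda>j. s - 1 - j"], rule bij_betwI[of _ _ _ "\<lambda>j. s - 1 - j"]) auto
  finally show ?thesis .
qed

text \<open>Cauchy-Schwarz: if p is isotropic, then the value of the form at x^i + t p is affine in
  t with slope 2 b, where b pairs x^i with p; being nonnegative for all t forces b = 0.\<close>

lemma psd_hank_kernel_iff:
  assumes "psd_mat (hank w a s)"
  shows "p \<in> hank_kernel w a s \<longleftrightarrow> p \<in> polys_below s \<and> riesz w (monom 1 a * (p * p)) = 0"
proof safe
  assume p: "p \<in> hank_kernel w a s"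
  then show pb: "p \<in> polys_below s" by (simp add: hank_kernel_def)
  show "riesz w (monom 1 a * (p * p)) = 0"
    using p hank_bilinear[OF pb pb, of w a] hank_kernel_iff[OF pb, of w a] by simp
next
  assume p: "p \<in> polys_below s" "riesz w (monom 1 a * (p * p)) = 0"
  have "riesz w (monom 1 (a + i) * p) = 0" if "i < s" for i
  proof (rule ccontr)
    define b where "b = riesz w (monom 1 (a + i) * p)"
    define e where "e = riesz w (monom 1 a * (monom 1 i * monom 1 i))"
    assume "riesz w (monom 1 (a + i) * p) \<noteq> 0"
    then have b: "b \<noteq> 0" by (simp add: b_def)
    have ineq: "0 \<le> e + 2 * t * b" for t
    proof -
      let ?q = "monom 1 i + Polynomial.smult t p"
      have "?q \<in> polys_below s"
        using p that by (intro polys_below_add polys_below_smult monom_in_polys_below)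
      then have "0 \<le> riesz w (monom 1 a * (?q * ?q))" using assms by (auto simp: psd_hank_iff)
      also have "monom 1 a * (?q * ?q) = monom 1 a * (monom 1 i * monom 1 i)
          + Polynomial.smult (2 * t) (monom 1 (a + i) * p)
          + Polynomial.smult (t * t) (monom 1 a * (p * p))"
        by (simp add: poly_monom power_add algebra_simps fun_eq_iff flip: poly_eq_poly_eq_iff)
      finally show ?thesis by (simp add: riesz_add p(2) b_def e_def)
    qed
    \<comment> \<open>This t turns the affine expression into e - \<bar>e\<bar> - 1, which is
      negative.\<close>
    have "2 * (- (\<bar>e\<bar> + 1) / (2 * b)) * b = - (\<bar>e\<bar> + 1)" using b by simp
    with ineq[of "- (\<bar>e\<bar> + 1) / (2 * b)"] show False by linarith
  qed
  with p show "p \<in> hank_kernel w a s" by (simp add: hank_kernel_def)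
qed

text \<open>By positivity the kernel of the smaller matrix is the set of kernel elements of degree
  below n. The two sets of missed degrees can therefore differ only at n.\<close>

lemma mat_rank_hank_eq_butlast_iff:
  assumes "psd_mat (hank w 0 (Suc n))"
  shows "mat_rank (hank w 0 (Suc n)) = mat_rank (hank w 0 n) \<longleftrightarrow>
         (\<exists>p\<in>hank_kernel w 0 (Suc n). p \<noteq> 0 \<and> degree p = n)"
proof -
  have psd': "psd_mat (hank w 0 n)"
    using assms polys_below_mono[of _ n "Suc n"] by (auto simp: psd_hank_iff)
  have ker: "p \<in> hank_kernel w 0 n \<longleftrightarrow> p \<in> hank_kernel w 0 (Suc n) \<and> p \<in> polys_below n" for p
    using psd_hank_kernel_iff[OF assms] psd_hank_kernel_iff[OF psd'] polys_below_mono[of p n "Suc n"]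
    by auto
  let ?J = "\<lambda>s. {j. j < s \<and> \<not> (\<exists>p\<in>hank_kernel w 0 s. p \<noteq> 0 \<and> degree p = j)}"
  have "?J (Suc n) = ?J n \<union> (if \<exists>p\<in>hank_kernel w 0 (Suc n). p \<noteq> 0 \<and> degree p = n then {} else {n})"
    using ker by (auto simp: less_Suc_eq polys_below_iff)
  then show ?thesis
    unfolding mat_rank_hank_degree by (auto simp: card_insert_if)
qed

text \<open>Multiplication by x identifies the kernel of \<open>hank w 2 n\<close> with the
  multiples of x in the large kernel. Vanishing orders shift by one, so the two counts can differ
  only through order 0.\<close>

lemma mat_rank_hank_eq_tl_iff:
  assumes "psd_mat (hank w 0 (Suc n))"
  shows "mat_rank (hank w 0 (Suc n)) = mat_rank (hank w 2 n) \<longleftrightarrow>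
         (\<exists>p\<in>hank_kernel w 0 (Suc n). coeff p 0 \<noteq> 0)"
proof -
  have sq: "monom 1 0 * (monom 1 1 * p * (monom 1 1 * p)) = monom 1 2 * (p * p)" for p :: "real poly"
    by (simp add: mult_monom algebra_simps numeral_2_eq_2 flip: mult.assoc one_pCons)
  have shift: "monom 1 1 * p \<in> polys_below (Suc n)" if "p \<in> polys_below n" for p
    using polys_below_monom_mult[OF that, of 1] by simp
  have psd': "psd_mat (hank w 2 n)"
    using assms shift unfolding psd_hank_iff by (metis sq)
  have ker: "p \<in> hank_kernel w 2 n \<longleftrightarrow> monom 1 1 * p \<in> hank_kernel w 0 (Suc n)" for p
  proof -
    have "monom 1 1 * p \<in> polys_below (Suc n) \<longleftrightarrow> p \<in> polys_below n"
      unfolding polys_below_def by (auto simp: coeff_monom_mult)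
    then show ?thesis
      using psd_hank_kernel_iff[OF assms] psd_hank_kernel_iff[OF psd'] by (simp only: sq) 
  qed
  let ?J = "\<lambda>a s. {j. j < s \<and> \<not> (\<exists>p\<in>hank_kernel w a s. coeff p j \<noteq> 0 \<and> (\<forall>i<j. coeff p i = 0))}"
  have *: "(\<exists>p\<in>hank_kernel w 0 (Suc n). coeff p (Suc j) \<noteq> 0 \<and> (\<forall>i<Suc j. coeff p i = 0)) \<longleftrightarrow>
        (\<exists>p\<in>hank_kernel w 2 n. coeff p j \<noteq> 0 \<and> (\<forall>i<j. coeff p i = 0))" for j
  proof
    assume "\<exists>p\<in>hank_kernel w 0 (Suc n). coeff p (Suc j) \<noteq> 0 \<and> (\<forall>i<Suc j. coeff p i = 0)"
    then obtain p where p: "p \<in> hank_kernel w 0 (Suc n)" "coeff p (Suc j) \<noteq> 0" "\<forall>i<Suc j. coeff p i = 0"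
      by blast
    define q where "q = poly_shift 1 p"
    from p(3) have q: "p = monom 1 1 * q"
      by (intro poly_eqI) (auto simp: q_def coeff_monom_mult coeff_poly_shift)
    have "q \<in> hank_kernel w 2 n" using p(1) q ker[of q] by simp
    moreover have "coeff q i = coeff p (Suc i)" for i by (simp add: q_def coeff_poly_shift)
    ultimately show "\<exists>p\<in>hank_kernel w 2 n. coeff p j \<noteq> 0 \<and> (\<forall>i<j. coeff p i = 0)"
      using p(2,3) by (intro bexI[of _ q]) auto
  next
    assume "\<exists>p\<in>hank_kernel w 2 n. coeff p j \<noteq> 0 \<and> (\<forall>i<j. coeff p i = 0)"
    then obtain p where "p \<in> hank_kernel w 2 n" "coeff p j \<noteq> 0" "\<forall>i<j. coeff p i = 0" by blast
    then show "\<exists>p\<in>hank_kernel w 0 (Suc n). coeff p (Suc j) \<noteq> 0 \<and> (\<forall>i<Suc j. coeff p i = 0)"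
      using ker[of p] by (intro bexI[of _ "monom 1 1 * p"]) (auto simp: coeff_monom_mult)
  qed
  have "?J 0 (Suc n) = Suc ` ?J 2 n \<union>
      (if \<exists>p\<in>hank_kernel w 0 (Suc n). coeff p 0 \<noteq> 0 then {} else {0})" (is "?L = ?R")
  proof (intro Set.set_eqI)
    fix j show "j \<in> ?L \<longleftrightarrow> j \<in> ?R"
    proof (cases j)
      case 0
      then show ?thesis by auto
    next
      case (Suc i)
      have "j \<in> ?R \<longleftrightarrow> i \<in> ?J 2 n" using Suc by auto
      moreover have "j \<in> ?L \<longleftrightarrow> i \<in> ?J 2 n" unfolding Suc mem_Collect_eq *[of i] by simp
      ultimately show ?thesis by blast
    qed
  qed
  then show ?thesis
    unfolding mat_rank_hank_order by (auto simp: card_insert_if card_image)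
qed

lemma seq_rank_full:
  assumes "\<And>p. p \<in> hank_kernel w 0 (Suc n) \<Longrightarrow> p = 0"
  shows "seq_rank w n = n + 1"
  using assms det_hank_eq_0_iff[of w 0 "Suc n"] by (auto simp: seq_rank_def)

text \<open>The first column dependent on its predecessors corresponds to the least degree of a
  nonzero kernel polynomial.\<close>

lemma seq_rank_eq_degree:
  assumes p: "p \<in> hank_kernel w 0 (Suc n)" "p \<noteq> 0"
    and least: "\<And>q. q \<in> hank_kernel w 0 (Suc n) \<Longrightarrow> q \<noteq> 0 \<Longrightarrow> degree p \<le> degree q"
  shows "seq_rank w n = degree p"
proof -
  let ?A = "hank w 0 (n + 1)"
  have dep: "(\<exists>c. col ?A j = finsum_vec TYPE(real) (n+1) (\<lambda>k. c k \<cdot>\<^sub>v col ?A k) {..<j}) \<longleftrightarrow>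
        (\<exists>p\<in>hank_kernel w 0 (Suc n). p \<noteq> 0 \<and> degree p = j)" if "j \<le> n" for j
  proof -
    have "(col ?A j = finsum_vec TYPE(real) (n+1) (\<lambda>k. c k \<cdot>\<^sub>v col ?A k) {..<j}) \<longleftrightarrow>
        (\<forall>i<Suc n. ?A $$ (i, j) = (\<Sum>k\<in>{..<j}. c k * ?A $$ (i, k)))" for c
    proof -
      have carr: "(\<lambda>k. c k \<cdot>\<^sub>v col ?A k) \<in> {..<j} \<rightarrow> carrier_vec (n + 1)"
        by (auto intro!: carrier_vecI)
      have "finsum_vec TYPE(real) (n+1) (\<lambda>k. c k \<cdot>\<^sub>v col ?A k) {..<j} $ i =
          (\<Sum>k\<in>{..<j}. c k * ?A $$ (i, k))" if "i < n + 1" for i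
        using that \<open>j \<le> n\<close> by (subst index_finsum_vec[OF _ that carr]) auto
      moreover have "dim_vec (finsum_vec TYPE(real) (n+1) (\<lambda>k. c k \<cdot>\<^sub>v col ?A k) {..<j}) = n + 1"
        by (rule carrier_vecD[OF finsum_vec_closed[OF carr]])
      ultimately show ?thesis using \<open>j \<le> n\<close> by (auto simp: vec_eq_iff)
    qed
    then show ?thesis
      using hank_column_dependent_iff[of "{..<j}" "Suc n" j w 0] \<open>j \<le> n\<close>
      unfolding degree_eq_iff_coeff by simp
  qed
  have deg: "degree p \<le> n" using p(1) by (simp add: hank_kernel_def polys_below_Suc_iff)
  have det: "det ?A = 0" using det_hank_eq_0_iff[of w 0 "Suc n"] p by auto
  have "(LEAST j. \<exists>c. col ?A j = finsum_vec TYPE(real) (n+1) (\<lambda>k. c k \<cdot>\<^sub>v col ?A k) {..<j}) = degree p"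
  proof (rule Least_equality)
    show "\<exists>c. col ?A (degree p) = finsum_vec TYPE(real) (n+1) (\<lambda>k. c k \<cdot>\<^sub>v col ?A k) {..<degree p}"
      using dep[OF deg] p by blast
    fix j assume j: "\<exists>c. col ?A j = finsum_vec TYPE(real) (n+1) (\<lambda>k. c k \<cdot>\<^sub>v col ?A k) {..<j}"
    show "degree p \<le> j"
    \<comment> \<open>The \<open>LEAST\<close> ranges over all naturals, and for j > n
      \<open>col\<close> has no meaning here; such j are harmless because \<open>degree p\<close> is
      at most n.\<close>
    proof (cases "j \<le> n")
      case True
      with j dep[OF True] least show ?thesis by blast
    qed (use deg in simp)
  qed
  with det show ?thesis by (simp add: seq_rank_def)
qed

subsection \<open>Quadrature at the roots of a generator\<close>

text \<open>The bound \<open>2 * n - degree p\<close> is the largest for which x^k p has degree at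
  most 2n, so only w_0, ..., w_2n are involved. Positivity below the degree makes p a kernel
  polynomial of least degree. The condition p(0) \<noteq> 0 is kept separate, as it belongs to the
  reversed sequence.\<close>

definition is_generator :: "(nat \<Rightarrow> real) \<Rightarrow> nat \<Rightarrow> real poly \<Rightarrow> bool" where
  "is_generator w n p \<longleftrightarrow> lead_coeff p = 1 \<and> degree p \<le> n \<and>
     (\<forall>k\<le>2 * n - degree p. riesz w (monom 1 k * p) = 0) \<and>
     (\<forall>q\<in>polys_below (degree p). q \<noteq> 0 \<longrightarrow> riesz w (q * q) > 0)"

lemma is_generator_mult:
  assumes "is_generator w n p" "f \<in> polys_below (Suc (2 * n - degree p))"
  shows "riesz w (f * p) = 0"
  by (rule riesz_mult_eq_0[OF _ assms(2)]) (use assms(1) in \<open>simp add: is_generator_def\<close>)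

text \<open>The case b = 0 is included on purpose: there the factor is (x - a)^2, so the same
  computation excludes multiple real roots along with nonreal ones.\<close>

lemma is_generator_no_sum_of_squares_factor:
  assumes gen: "is_generator w n p"
  shows "\<not> [:- a, 1:] * [:- a, 1:] + [:b * b:] dvd p"
proof
  let ?l = "[:- a, 1:]"
  assume "?l * ?l + [:b * b:] dvd p"
  then obtain h where h: "p = (?l * ?l + [:b * b:]) * h" by (elim dvdE)
  have "p \<noteq> 0" using gen by (auto simp: is_generator_def)
  then have h0: "h \<noteq> 0" using h by auto
  have deg2: "degree (?l * ?l + [:b * b:]) = 2" by simp
  then have ne: "?l * ?l + [:b * b:] \<noteq> 0" by (metis degree_0 zero_neq_numeral)
  then have deg: "degree p = 2 + degree h"
    by (simp only: h degree_mult_eq[OF ne h0] deg2)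
  have "h \<in> polys_below (Suc (2 * n - degree p))"
    using deg gen by (auto simp: polys_below_iff is_generator_def)
  then have "riesz w (h * p) = 0" by (rule is_generator_mult[OF gen])
  also have "h * p = (?l * h) * (?l * h) + Polynomial.smult (b * b) (h * h)"
    unfolding h by (simp add: poly_eq_poly_eq_iff[symmetric] fun_eq_iff algebra_simps)
  finally have "riesz w ((?l * h) * (?l * h)) + b * b * riesz w (h * h) = 0"
    by (simp only: riesz_add riesz_smult)
  moreover have "?l * h \<in> polys_below (degree p)" "h \<in> polys_below (degree p)" "?l * h \<noteq> 0"
    using h0 deg by (auto simp: polys_below_iff degree_mult_eq simp del: mult_pCons_left)
  then have "riesz w ((?l * h) * (?l * h)) > 0" "riesz w (h * h) > 0"
    using gen h0 unfolding is_generator_def by blast+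
  moreover from mult_nonneg_nonneg[OF zero_le_square less_imp_le[OF this(2)]]
  have "b * b * riesz w (h * h) \<ge> 0" .
  ultimately show False by linarith
qed

section \<open>Simple real roots and Lagrange interpolation\<close>

lemma poly_map_poly_complex_of_real:
  "poly (map_poly complex_of_real (p + q)) z =
     poly (map_poly complex_of_real p) z + poly (map_poly complex_of_real q) z"
  "poly (map_poly complex_of_real (p * q)) z =
     poly (map_poly complex_of_real p) z * poly (map_poly complex_of_real q) z"
  "poly (map_poly complex_of_real p) (complex_of_real x) = complex_of_real (poly p x)"
proof -
  have "map_poly complex_of_real (p + q) = map_poly complex_of_real p + map_poly complex_of_real q"
    "map_poly complex_of_real (p * q) = map_poly complex_of_real p * map_poly complex_of_real q"
    by (intro poly_eqI; simp add: coeff_map_poly coeff_mult)+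
  then show "poly (map_poly complex_of_real (p + q)) z =
     poly (map_poly complex_of_real p) z + poly (map_poly complex_of_real q) z"
  "poly (map_poly complex_of_real (p * q)) z =
     poly (map_poly complex_of_real p) z * poly (map_poly complex_of_real q) z" by simp_all
  show "poly (map_poly complex_of_real p) (complex_of_real x) = complex_of_real (poly p x)"
    by (induction p) (simp_all add: map_poly_pCons)
qed

text \<open>Induction on the degree by splitting off a complex root z. A real z gives a linear
  factor, and a nonreal z would make p divisible by (x - Re z)^2 + (Im z)^2.\<close>

lemma poly_real_rooted:
  fixes p :: "real poly"
  assumes "lead_coeff p = 1" "\<And>a b. \<not> [:- a, 1:] * [:- a, 1:] + [:b * b:] dvd p"
  shows "\<exists>X. finite X \<and> p = (\<Prod>x\<in>X. [:- x, 1:])"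
  using assms
proof (induction "degree p" arbitrary: p)
  case 0
  then obtain a where "p = [:a:]" by (metis degree_eq_zeroE)
  with 0(2) have "p = 1" by (simp add: one_pCons)
  then show ?case by (intro exI[of _ "{}"]) simp
next
  case (Suc d p)
  let ?P = "map_poly complex_of_real p"
  have "degree ?P = Suc d" using Suc(2) by (simp add: degree_map_poly)
  then have "\<not> constant (poly ?P)" by (simp add: constant_degree)
  then obtain z where z: "poly ?P z = 0" using fundamental_theorem_of_algebra by blast
  show ?case
  proof (cases "Im z = 0")
    case True
    then have "z = complex_of_real (Re z)" by (simp add: complex_eq_iff)
    then have "poly p (Re z) = 0" using z
      by (metis of_real_eq_0_iff poly_map_poly_complex_of_real(3))
    then obtain h where h: "p = [:- Re z, 1:] * h" by (metis poly_eq_0_iff_dvd dvdE)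
    have lead: "lead_coeff h = 1" using Suc(3) unfolding h lead_coeff_mult by simp
    then have "h \<noteq> 0" by auto
    then have "degree p = 1 + degree h" unfolding h by (subst degree_mult_eq) auto
    then have "d = degree h" using Suc(2) by simp
    moreover have "\<not> [:- a, 1:] * [:- a, 1:] + [:b * b:] dvd h" for a b
      using Suc(4)[of a b] unfolding h by (metis dvd_mult)
    ultimately obtain X where X: "finite X" "h = (\<Prod>x\<in>X. [:- x, 1:])"
      using Suc(1)[of h] lead by blast
    have "Re z \<notin> X"
    proof
      assume "Re z \<in> X"
      then have "[:- Re z, 1:] dvd h" unfolding X(2) using X(1) by (rule dvd_prodI[rotated])
      \<comment> \<open>A repeated root yields the forbidden factor with b = 0.\<close>
      then have "[:- Re z, 1:] * [:- Re z, 1:] + [:0 * 0:] dvd p"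
        unfolding h by (simp only: mult_zero_left pCons_0_0 add_0_right mult_dvd_mono dvd_refl)
      with Suc(4) show False by blast
    qed
    then show ?thesis using X h by (intro exI[of _ "insert (Re z) X"]) simp
  next
    case False
    define a b where "a = Re z" and "b = Im z"
    define s where "s = [:- a, 1:] * [:- a, 1:] + [:b * b:]"
    have deg: "degree s = 2" by (simp add: s_def)
    then have "s \<noteq> 0" by auto
    then have "degree (p mod s) < 2" using degree_mod_less[of s p] deg by auto
    define c d where "c = coeff (p mod s) 0" and "d = coeff (p mod s) 1"
    have R: "p mod s = [:c, d:]"
      using \<open>degree (p mod s) < 2\<close>
      by (intro poly_eqI) (auto simp: c_def d_def coeff_pCons coeff_eq_0 split: nat.split)
    have "p = s * (p div s) + [:c, d:]" using R by (metis mult_div_mod_eq)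
    then have "poly ?P z = poly (map_poly complex_of_real s) z * poly (map_poly complex_of_real (p div s)) z
        + poly (map_poly complex_of_real [:c, d:]) z"
      by (metis poly_map_poly_complex_of_real(1,2))
    moreover have "poly (map_poly complex_of_real s) z = 0"
      by (simp add: s_def map_poly_pCons complex_eq_iff a_def b_def algebra_simps)
    ultimately have "complex_of_real c + z * complex_of_real d = 0"
      using z by (simp add: map_poly_pCons)
    \<comment> \<open>The remainder c + d x is real and vanishes at a nonreal point: the imaginary
      part gives d = 0, then the real part c = 0.\<close>
    then have "d = 0" "c = 0" using False by (auto simp: complex_eq_iff)
    then have "s dvd p" using R by (simp add: mod_eq_0_iff_dvd)
    then show ?thesis using Suc(4) unfolding s_def by blast
  qed
qed

lemma prod_linear_poly:
  fixes X :: "real set"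
  assumes "finite X"
  shows "degree (\<Prod>x\<in>X. [:- x, 1:]) = card X"
    and "lead_coeff (\<Prod>x\<in>X. [:- x, 1:]) = 1"
    and "{x. poly (\<Prod>x\<in>X. [:- x, 1:]) x = 0} = X"
proof -
  show "degree (\<Prod>x\<in>X. [:- x, 1:]) = card X" by (simp add: degree_prod_eq_sum_degree)
  show "lead_coeff (\<Prod>x\<in>X. [:- x, 1:]) = 1" by (subst lead_coeff_prod) simp
  show "{x. poly (\<Prod>x\<in>X. [:- x, 1:]) x = 0} = X" using assms by (auto simp: poly_prod)
qed

definition lagrange_basis :: "real set \<Rightarrow> real \<Rightarrow> real poly" where
  "lagrange_basis X c =
     Polynomial.smult (1 / (\<Prod>d\<in>X - {c}. c - d)) (\<Prod>d\<in>X - {c}. [:- d, 1:])"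

lemma poly_lagrange_basis:
  assumes "finite X" "c \<in> X" "x \<in> X"
  shows "poly (lagrange_basis X c) x = (if x = c then 1 else 0)"
proof (cases "x = c")
  case True
  have "(\<Prod>d\<in>X - {c}. c - d) \<noteq> 0" using assms(1) by (subst prod_zero_iff) auto
  then show ?thesis using True by (simp add: lagrange_basis_def poly_prod)
next
  case False
  then have "(\<Prod>d\<in>X - {c}. x - d) = 0" using assms by (subst prod_zero_iff) auto
  then show ?thesis using False by (simp add: lagrange_basis_def poly_prod)
qed

lemma lagrange_basis_in_polys_below:
  assumes "finite X" "c \<in> X"
  shows "lagrange_basis X c \<in> polys_below (card X)"
proof -
  have "degree (\<Prod>d\<in>X - {c}. [:- d, 1:]) < card X"
    using assms card_Diff1_less[OF assms] by (simp add: prod_linear_poly)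
  then show ?thesis
    unfolding lagrange_basis_def by (intro polys_below_smult) (simp add: polys_below_iff)
qed

lemma lagrange_interpolation:
  assumes "finite X" "g \<in> polys_below (card X)"
  shows "g = (\<Sum>c\<in>X. Polynomial.smult (poly g c) (lagrange_basis X c))" (is "g = ?h")
\<comment> \<open>For empty X the bound \<open>degree g < card X\<close> is impossible, while
  \<open>polys_below 0\<close> still contains g = 0.\<close>
proof (cases "X = {}")
  case False
  have h: "?h \<in> polys_below (card X)"
  proof -
    have "(\<Sum>c\<in>Y. Polynomial.smult (poly g c) (lagrange_basis X c)) \<in> polys_below (card X)" if "Y \<subseteq> X" for Y
      using finite_subset[OF that assms(1)] that
      by (induction Y rule: finite_induct)
        (auto simp: zero_in_polys_below intro!: polys_below_add polys_below_smult
          lagrange_basis_in_polys_below assms(1))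
    then show ?thesis by blast
  qed
  have pos: "card X > 0" using False assms(1) by (simp add: card_gt_0_iff)
  have eq: "poly g x = poly ?h x" if "x \<in> X" for x
    using assms(1) that by (simp add: poly_sum poly_lagrange_basis if_distrib cong: if_cong)
  show ?thesis
  proof (rule poly_eqI_degree[of X])
    show "degree g < card X" using assms(2) pos by (auto simp: polys_below_iff)
    show "degree ?h < card X"
      using h pos unfolding polys_below_iff by (metis degree_0)
  qed (rule eq)
qed (use assms in simp)

lemma poly_div_in_polys_below:
  fixes f p :: "real poly"
  assumes "p \<noteq> 0" "f \<in> polys_below (degree p + s)"
  shows "f div p \<in> polys_below s"
proof (cases "f div p = 0")
  case False
  have f: "f = p * (f div p) + f mod p" by simp
  have deg: "degree (p * (f div p)) = degree p + degree (f div p)"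
    using assms(1) False by (rule degree_mult_eq)
  have "degree f = degree p + degree (f div p)"
  proof (cases "f mod p = 0")
    case True
    with f deg show ?thesis by simp
  next
    case False
    then have "degree (f mod p) < degree (p * (f div p))"
      using degree_mod_less[OF assms(1), of f] deg by simp
    with deg show ?thesis by (metis degree_add_eq_left f)
  qed
  moreover have "f \<noteq> 0" using False by auto
  ultimately show ?thesis using assms(2) by (simp add: polys_below_iff)
qed (simp add: zero_in_polys_below)

text \<open>This is Gauss quadrature: since the quotient \<open>f div p\<close> has degree at most
  2n - deg p, it contributes nothing, and L(f) depends only on the values of f at the roots of
  p.\<close>

lemma is_generator_quadrature:
  assumes gen: "is_generator w n p"
  obtains X \<rho> where "finite X" "p = (\<Prod>x\<in>X. [:- x, 1:])" "\<And>x. x \<in> X \<Longrightarrow> \<rho> x > 0"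
    "\<And>f. f \<in> polys_below (Suc (2 * n)) \<Longrightarrow> riesz w f = (\<Sum>x\<in>X. \<rho> x * poly f x)"
proof -
  have "lead_coeff p = 1" using gen by (simp add: is_generator_def)
  then obtain X where X: "finite X" "p = (\<Prod>x\<in>X. [:- x, 1:])"
    using poly_real_rooted is_generator_no_sum_of_squares_factor[OF gen] by blast
  then have deg: "degree p = card X" by (simp add: prod_linear_poly)
  have p0: "p \<noteq> 0" and degn: "degree p \<le> n" using gen by (auto simp: is_generator_def)
  have roots: "poly p x = 0" if "x \<in> X" for x using X that by (auto simp: poly_prod)
  let ?\<rho> = "\<lambda>x. riesz w (lagrange_basis X x)"
  have quad: "riesz w f = (\<Sum>x\<in>X. ?\<rho> x * poly f x)" if f: "f \<in> polys_below (Suc (2 * n))" for f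
  proof -
    have "f div p \<in> polys_below (Suc (2 * n - degree p))"
      using f degn by (intro poly_div_in_polys_below p0) simp
    then have "riesz w (f div p * p) = 0" by (rule is_generator_mult[OF gen])
    then have "riesz w f = riesz w (f mod p)"
      using riesz_add[of w "f div p * p" "f mod p"] by simp
    also have "f mod p \<in> polys_below (card X)"
      using degree_mod_less[OF p0, of f] deg by (auto simp: polys_below_iff)
    then have "f mod p = (\<Sum>c\<in>X. Polynomial.smult (poly (f mod p) c) (lagrange_basis X c))"
      by (rule lagrange_interpolation[OF X(1)])
    then have "riesz w (f mod p) = (\<Sum>c\<in>X. poly (f mod p) c * ?\<rho> c)"
      by (metis (no_types, lifting) riesz_smult riesz_sum sum.cong)
    also have "\<dots> = (\<Sum>c\<in>X. ?\<rho> c * poly f c)"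
      using roots by (intro sum.cong) (simp_all add: poly_mod)
    finally show ?thesis .
  qed
  \<comment> \<open>The square of the Lagrange polynomial l of c has degree at most 2n and takes the
    values 1 at c and 0 at the other nodes. Quadrature gives L(l^2) = L(l), and the left side is
    positive.\<close>
  have "?\<rho> c > 0" if c: "c \<in> X" for c
  proof -
    let ?l = "lagrange_basis X c"
    have lb: "?l \<in> polys_below (degree p)"
      using lagrange_basis_in_polys_below[OF X(1) c] deg by simp
    have "poly ?l c = 1" using poly_lagrange_basis[OF X(1) c c] by simp
    then have "?l \<noteq> 0" by auto
    with lb gen have "riesz w (?l * ?l) > 0" by (simp add: is_generator_def)
    also have "?l * ?l \<in> polys_below (Suc (2 * n))"
      using lb degn degree_mult_le[of ?l ?l] by (auto simp: polys_below_iff)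
    then have "riesz w (?l * ?l) = (\<Sum>x\<in>X. ?\<rho> x * poly (?l * ?l) x)" by (rule quad)
    also have "\<dots> = (\<Sum>x\<in>X. if x = c then ?\<rho> c else 0)"
      using poly_lagrange_basis[OF X(1) c] by (intro sum.cong) auto
    also have "\<dots> = ?\<rho> c" using X(1) c by simp
    finally show ?thesis .
  qed
  with X quad show ?thesis using that[of X ?\<rho>] by blast
qed

lemma riesz_atomic:
  assumes "\<And>j. j < s \<Longrightarrow> w j = (\<Sum>x\<in>X. \<rho> x * x ^ j)" "f \<in> polys_below s"
  shows "riesz w f = (\<Sum>x\<in>X. \<rho> x * poly f x)"
proof (cases "f = 0")
  case False
  then have "degree f < s" using assms(2) by (simp add: polys_below_iff)
  then have "riesz w f = (\<Sum>i\<le>degree f. coeff f i * (\<Sum>x\<in>X. \<rho> x * x ^ i))"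
    unfolding riesz_def using assms(1) by (intro sum.cong) auto
  also have "\<dots> = (\<Sum>x\<in>X. \<rho> x * (\<Sum>i\<le>degree f. coeff f i * x ^ i))"
    by (simp add: sum_distrib_left mult_ac sum.swap[of _ X])
  finally show ?thesis by (simp add: poly_altdef)
qed simp

text \<open>The node polynomial annihilates its multiples, and L(q^2) > 0 because a nonzero q of
  degree below \<open>card X\<close> cannot vanish at every node.\<close>

lemma atomic_is_generator:
  assumes X: "finite X" "card X \<le> n" and pos: "\<And>x. x \<in> X \<Longrightarrow> \<rho> x > 0"
    and w: "\<And>j. j \<le> 2 * n \<Longrightarrow> w j = (\<Sum>x\<in>X. \<rho> x * x ^ j)"
  shows "is_generator w n (\<Prod>x\<in>X. [:- x, 1:])"
proof -
  let ?p = "\<Prod>x\<in>X. [:- x, 1:]"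
  note p = prod_linear_poly[OF X(1)]
  have riesz: "riesz w f = (\<Sum>x\<in>X. \<rho> x * poly f x)" if "f \<in> polys_below (Suc (2 * n))" for f
    using w that by (intro riesz_atomic) auto
  have "riesz w (monom 1 k * ?p) = 0" if "k \<le> 2 * n - card X" for k
  proof -
    have "monom 1 k * ?p \<in> polys_below (k + Suc (card X))"
      by (intro polys_below_monom_mult) (simp add: polys_below_iff p)
    then have "monom 1 k * ?p \<in> polys_below (Suc (2 * n))"
      by (rule polys_below_mono) (use that X(2) in simp)
    then have "riesz w (monom 1 k * ?p) = (\<Sum>x\<in>X. \<rho> x * poly (monom 1 k * ?p) x)"
      by (rule riesz)
    also have "\<dots> = 0" using p(3) by (intro sum.neutral) auto
    finally show ?thesis .
  qed
  moreover have "riesz w (q * q) > 0" if q: "q \<in> polys_below (card X)" "q \<noteq> 0" for q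
  proof -
    have "q * q \<in> polys_below (Suc (2 * n))"
      using q X(2) degree_mult_le[of q q] by (auto simp: polys_below_iff)
    then have eq: "riesz w (q * q) = (\<Sum>x\<in>X. \<rho> x * (poly q x * poly q x))" by (simp add: riesz)
    have "\<exists>x\<in>X. poly q x \<noteq> 0"
      using poly_eqI_degree[of X q 0] q by (auto simp: polys_below_iff)
    then obtain x where x: "x \<in> X" "poly q x \<noteq> 0" by blast
    show ?thesis unfolding eq
    proof (rule sum_pos2[OF X(1) x(1)])
      show "0 < \<rho> x * (poly q x * poly q x)"
        using pos[OF x(1)] x(2) by (simp add: zero_less_mult_iff linorder_neq_iff) linarith
      show "0 \<le> \<rho> y * (poly q y * poly q y)" if "y \<in> X" for y
        using pos[OF that] by simp
    qed
  qed
  ultimately show ?thesis using X(2) p(2) by (simp add: is_generator_def p(1))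
qed

subsection \<open>Generators and recursively generated sequences\<close>

lemma hank_kernel_least:
  assumes "p \<in> hank_kernel w a s" "p \<noteq> 0"
  obtains q where "q \<in> hank_kernel w a s" "lead_coeff q = 1"
    "\<And>f. f \<in> hank_kernel w a s \<Longrightarrow> f \<noteq> 0 \<Longrightarrow> degree q \<le> degree f"
proof -
  obtain f where f: "f \<in> hank_kernel w a s" "f \<noteq> 0"
    "\<And>g. g \<in> hank_kernel w a s \<and> g \<noteq> 0 \<Longrightarrow> degree f \<le> degree g"
    using exists_least_iff[of "\<lambda>d. \<exists>f\<in>hank_kernel w a s. f \<noteq> 0 \<and> degree f = d"] assms
    by (metis not_le)
  show ?thesis
  proof (rule that[of "Polynomial.smult (1 / lead_coeff f) f"])
    show "Polynomial.smult (1 / lead_coeff f) f \<in> hank_kernel w a s"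
      using f(1) by (rule hank_kernel_smult)
    show "lead_coeff (Polynomial.smult (1 / lead_coeff f) f) = 1" using f(2) by simp
    show "degree (Polynomial.smult (1 / lead_coeff f) f) \<le> degree g"
      if "g \<in> hank_kernel w a s" "g \<noteq> 0" for g
      using f(2) f(3)[of g] that by simp
  qed
qed

lemma seq_rank_le: "seq_rank w n \<le> n + 1"
proof (cases "\<exists>p\<in>hank_kernel w 0 (Suc n). p \<noteq> 0")
  case True
  then obtain q where q: "q \<in> hank_kernel w 0 (Suc n)" "lead_coeff q = 1"
    "\<And>f. f \<in> hank_kernel w 0 (Suc n) \<Longrightarrow> f \<noteq> 0 \<Longrightarrow> degree q \<le> degree f"
    using hank_kernel_least by metis
  then have "q \<noteq> 0" by auto
  then have "seq_rank w n = degree q" using q(1,3) by (intro seq_rank_eq_degree) auto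
  with q(1) show ?thesis by (simp add: hank_kernel_def polys_below_Suc_iff)
next
  case False
  then show ?thesis using seq_rank_full[of w n] by auto
qed

lemma is_generator_in_kernel:
  assumes "is_generator w n p"
  shows "p \<in> hank_kernel w 0 (Suc n)" "p \<noteq> 0"
  using assms by (auto simp: is_generator_def hank_kernel_def polys_below_Suc_iff)

lemma is_generator_least:
  assumes gen: "is_generator w n p" and q: "q \<in> hank_kernel w 0 (Suc n)" "q \<noteq> 0"
  shows "degree p \<le> degree q"
proof (rule ccontr)
  assume less: "\<not> degree p \<le> degree q"
  then have "q \<in> polys_below (degree p)" by (simp add: polys_below_iff)
  then have "riesz w (q * q) > 0" using gen q(2) by (auto simp: is_generator_def)
  moreover have "riesz w (q * q) = 0"
    by (rule riesz_mult_eq_0[of n]) (use q(1) in \<open>auto simp: hank_kernel_def\<close>)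
  ultimately show False by simp
qed

lemma is_generator_seq_rank:
  assumes "is_generator w n p"
  shows "seq_rank w n = degree p"
  using is_generator_in_kernel[OF assms] is_generator_least[OF assms] by (rule seq_rank_eq_degree)

lemma is_generator_pd:
  assumes "is_generator w n p"
  shows "pd_mat (hank w 0 (degree p))"
  using assms by (simp add: pd_hank_iff is_generator_def)

text \<open>Dictionary between orthogonality and linear recurrences: the recurrence coefficients are
  the negated lower coefficients of p.\<close>

lemma riesz_monom_mult_monic_eq_0_iff:
  assumes "lead_coeff p = 1"
  shows "riesz w (monom 1 k * p) = 0 \<longleftrightarrow>
         w (k + degree p) = (\<Sum>i<degree p. - coeff p i * w (k + i))"
proof -
  have "riesz w (monom 1 k * p) = (\<Sum>i\<le>degree p. coeff p i * w (k + i))"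
    by (rule riesz_monom_mult_sum) (auto simp: coeff_eq_0)
  also have "\<dots> = (\<Sum>i<degree p. coeff p i * w (k + i)) + w (k + degree p)"
    using assms by (simp flip: lessThan_Suc_atMost)
  finally show ?thesis by (auto simp: sum_negf)
qed

text \<open>The relations L(x^i p) = 0 for i < r say that the coefficients of x^r - p solve the
  linear system defining \<phi>.\<close>

lemma is_generator_prg_phi:
  assumes gen: "is_generator w n p"
  shows "prg_phi w n = vec (degree p) (\<lambda>i. - coeff p i)"
proof -
  let ?r = "degree p" and ?q = "monom 1 (degree p) - p"
  have lead: "lead_coeff p = 1" using gen by (simp add: is_generator_def)
  have below: "?q \<in> polys_below ?r"
    using lead by (auto simp: polys_below_def coeff_eq_0 le_less)
  have phi: "vec ?r (\<lambda>i. - coeff p i) = vec ?r (coeff ?q)" by (auto simp: vec_eq_iff)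
  have rec: "riesz w (monom 1 i * p) = 0" if "i < ?r" for i
    using gen that by (auto simp: is_generator_def)
  have "hank w 0 ?r *\<^sub>v vec ?r (coeff ?q) = vec ?r (\<lambda>i. riesz w (monom 1 i * ?q))"
    using hank_mult_vec[OF below, of w 0] by simp
  also have "\<dots> = vec ?r (\<lambda>i. w (?r + i))"
    using rec by (auto simp: vec_eq_iff right_diff_distrib riesz_diff mult_monom riesz_monom add.commute)
  finally have "inv_mat (hank w 0 ?r) *\<^sub>v vec ?r (\<lambda>i. w (?r + i)) = vec ?r (coeff ?q)"
    using pd_mat_det_nonzero[OF hank_carrier is_generator_pd[OF gen]]
    by (subst inv_mat_mult_vec_eq_iff[OF hank_carrier]) auto
  then show ?thesis
    unfolding prg_phi_def is_generator_seq_rank[OF gen] Let_def phi .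
qed

lemma is_generator_gen_poly:
  assumes gen: "is_generator w n p"
  shows "gen_poly w n = p"
proof -
  have lead: "lead_coeff p = 1" using gen by (simp add: is_generator_def)
  have "gen_poly w n = monom 1 (degree p) - (\<Sum>i<degree p. monom (- coeff p i) i)"
    unfolding gen_poly_def is_generator_prg_phi[OF gen] is_generator_seq_rank[OF gen] Let_def
    by (intro arg_cong2[where f = minus] sum.cong refl) auto
  also have "\<dots> = p"
    using lead by (intro poly_eqI) (auto simp: coeff_sum coeff_eq_0 linorder_neq_iff)
  finally show ?thesis .
qed

lemma is_generator_prg:
  assumes gen: "is_generator w n p"
  shows "prg w n"
proof -
  let ?r = "degree p"
  have lead: "lead_coeff p = 1" using gen by (simp add: is_generator_def)
  have "w j = (\<Sum>i<?r. vec ?r (\<lambda>i. - coeff p i) $ i * w (j - ?r + i))"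
    if j: "j \<in> {?r..2 * n}" for j
  proof -
    have "riesz w (monom 1 (j - ?r) * p) = 0"
      using gen j by (auto simp: is_generator_def)
    then have "w (j - ?r + ?r) = (\<Sum>i<?r. - coeff p i * w (j - ?r + i))"
      by (simp add: riesz_monom_mult_monic_eq_0_iff[OF lead])
    moreover have "(\<Sum>i<?r. vec ?r (\<lambda>i. - coeff p i) $ i * w (j - ?r + i)) =
        (\<Sum>i<?r. - coeff p i * w (j - ?r + i))"
      by (intro sum.cong) auto
    ultimately show ?thesis using j by simp
  qed
  then show ?thesis
    unfolding prg_def is_generator_prg_phi[OF gen] is_generator_seq_rank[OF gen] Let_def
    using is_generator_pd[OF gen] by blast
qed

lemma prg_is_generator:
  assumes prg: "prg w n" and r: "seq_rank w n \<le> n"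
  shows "is_generator w n (gen_poly w n)"
proof -
  let ?r = "seq_rank w n" and ?p = "gen_poly w n"
  have pd: "pd_mat (hank w 0 ?r)"
    and rec: "\<And>j. j \<in> {?r..2 * n} \<Longrightarrow> w j = (\<Sum>i<?r. prg_phi w n $ i * w (j - ?r + i))"
    using prg r unfolding prg_def Let_def by auto
  have coeff: "coeff ?p i = (if i = ?r then 1 else if i < ?r then - prg_phi w n $ i else 0)" for i
    by (auto simp: gen_poly_def Let_def coeff_sum)
  have deg: "degree ?p = ?r"
    by (intro antisym degree_le le_degree) (auto simp: coeff)
  have lead: "lead_coeff ?p = 1" by (simp add: deg coeff)
  have "riesz w (monom 1 k * ?p) = 0" if "k \<le> 2 * n - ?r" for k
    using rec[of "k + ?r"] that r
    by (simp add: riesz_monom_mult_monic_eq_0_iff[OF lead] deg coeff)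
  with r lead pd show ?thesis by (simp add: is_generator_def deg pd_hank_iff)
qed

text \<open>The backward recurrence gives a polynomial q with q(0) = 1 and L(q^2) = 0. By quadrature
  with positive weights q vanishes at every node, so 0 is not a node.\<close>

lemma is_generator_nrg_imp_coeff_0:
  assumes gen: "is_generator w n p" and nrg: "nrg w n"
  shows "coeff p 0 \<noteq> 0"
proof
  assume zero: "coeff p 0 = 0"
  obtain X \<rho> where X: "finite X" "p = (\<Prod>x\<in>X. [:- x, 1:])" "\<And>x. x \<in> X \<Longrightarrow> \<rho> x > 0"
    and quad: "\<And>f. f \<in> polys_below (Suc (2 * n)) \<Longrightarrow> riesz w f = (\<Sum>x\<in>X. \<rho> x * poly f x)"
    using is_generator_quadrature[OF gen] by metis
  have "poly p 0 = 0" using zero by (simp add: poly_0_coeff_0)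
  then have X0: "0 \<in> X" using X(1) unfolding X(2) by (simp add: poly_prod prod_zero_iff)
  define r where "r = seq_rank (\<lambda>i. w (2 * n - i)) n"
  define \<psi> where
    "\<psi> = inv_mat (hank w (2 * (n + 1 - r)) r) *\<^sub>v vec r (\<lambda>i. w (2 * n - 2 * r + 1 + i))"
  have pd: "pd_mat (hank w (2 * (n + 1 - r)) r)"
    and rec: "r < n + 1 \<Longrightarrow>
      \<forall>j\<in>{0..2 * n - r}. w (2 * n - r - j) = (\<Sum>i<r. \<psi> $ i * w (2 * n - r + 1 - j + i))"
    using nrg unfolding nrg_def Let_def r_def[symmetric] \<psi>_def[symmetric] by auto
  have "r \<noteq> n + 1"
  proof
    assume "r = n + 1"
    then have "pd_mat (hank w 0 (Suc n))" using pd by simp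
    then have "det (hank w 0 (Suc n)) \<noteq> 0" by (rule pd_mat_det_nonzero[OF hank_carrier])
    with is_generator_in_kernel[OF gen] show False by (auto simp: det_hank_eq_0_iff)
  qed
  then have r: "r \<le> n" using seq_rank_le[of "\<lambda>i. w (2 * n - i)" n] by (simp add: r_def)
  \<comment> \<open>This is the backward recurrence w_k = (sum of \<psi>_i w_(k+1+i)) rewritten as
    L(x^k q) = 0.\<close>
  define q where "q = 1 - (\<Sum>i<r. monom (\<psi> $ i) (Suc i))"
  have "coeff q i = 0" if "i > r" for i
    using that by (auto simp: q_def coeff_sum)
  then have q: "q \<in> polys_below (Suc r)" by (simp add: polys_below_def)
  \<comment> \<open>The index j = 2n - r - k of the recurrence yields the relation for w_k; r \<le>
    n keeps j nonnegative for all k \<le> r, which suffices as q has degree at most r.\<close>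
  have "riesz w (monom 1 k * q) = 0" if "k \<le> r" for k
  proof -
    have "2 * n - r - (2 * n - r - k) = k" "2 * n - r + 1 - (2 * n - r - k) = k + 1"
      using r that by simp_all
    moreover have "w (2 * n - r - (2 * n - r - k)) =
        (\<Sum>i<r. \<psi> $ i * w (2 * n - r + 1 - (2 * n - r - k) + i))"
      using r by (intro bspec[OF rec]) auto
    ultimately have "w k = (\<Sum>i<r. \<psi> $ i * w (k + Suc i))" by simp
    then show ?thesis
      by (simp add: q_def right_diff_distrib sum_distrib_left mult_monom riesz_diff riesz_sum riesz_monom)
  qed
  then have "riesz w (q * q) = 0" using q by (rule riesz_mult_eq_0)
  moreover have "q * q \<in> polys_below (Suc (2 * n))"
    using polys_below_mono[OF polys_below_mult[OF q q], of "Suc (2 * n)"] r by simp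
  ultimately have "(\<Sum>x\<in>X. \<rho> x * (poly q x * poly q x)) = 0" by (simp add: quad)
  moreover have "0 \<le> \<rho> x * (poly q x * poly q x)" if "x \<in> X" for x
    using X(3)[OF that] by simp
  ultimately have "\<rho> 0 * (poly q 0 * poly q 0) = 0"
    using sum_nonneg_eq_0_iff[OF X(1), of "\<lambda>x. \<rho> x * (poly q x * poly q x)"] X0 by blast
  moreover have "poly q 0 = 1" by (simp add: q_def poly_sum poly_monom)
  ultimately show False using X(3)[OF X0] by simp
qed

text \<open>Reversing the sequence is the substitution y = 1/x, with each weight multiplied by
  x^m.\<close>

lemma atomic_reverse:
  fixes X :: "real set" and w :: "nat \<Rightarrow> real"
  assumes X: "finite X" "0 \<notin> X" and w: "\<And>j. j \<le> m \<Longrightarrow> w j = (\<Sum>x\<in>X. \<rho> x * x ^ j)"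
    and j: "j \<le> m"
  shows "w (m - j) = (\<Sum>y\<in>inverse ` X. (\<rho> (inverse y) * inverse y ^ m) * y ^ j)"
proof -
  have "(\<Sum>y\<in>inverse ` X. (\<rho> (inverse y) * inverse y ^ m) * y ^ j)
      = (\<Sum>x\<in>X. \<rho> x * x ^ m * inverse x ^ j)"
    by (subst sum.reindex) (auto simp: inj_on_def)
  also have "\<dots> = (\<Sum>x\<in>X. \<rho> x * x ^ (m - j))"
  proof (intro sum.cong refl)
    fix x assume "x \<in> X"
    then have "x \<noteq> 0" using X(2) by auto
    then have "x ^ (m - j) = x ^ m / x ^ j" using j by (rule power_diff)
    then show "\<rho> x * x ^ m * inverse x ^ j = \<rho> x * x ^ (m - j)"
      by (simp add: field_simps)
  qed
  finally show ?thesis using w[of "m - j"] by simp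
qed

text \<open>All nodes are nonzero, so the reversed sequence is atomic at their inverses and has the
  same rank. Dividing the recurrence by p(0) solves it for its lowest term, which is the backward
  recurrence.\<close>

lemma is_generator_nrg:
  assumes gen: "is_generator w n p" and p0: "coeff p 0 \<noteq> 0"
  shows "nrg w n"
proof -
  let ?r = "degree p" and ?w' = "\<lambda>i. w (2 * n - i)"
  obtain X \<rho> where X: "finite X" "p = (\<Prod>x\<in>X. [:- x, 1:])" "\<And>x. x \<in> X \<Longrightarrow> \<rho> x > 0"
    and quad: "\<And>f. f \<in> polys_below (Suc (2 * n)) \<Longrightarrow> riesz w f = (\<Sum>x\<in>X. \<rho> x * poly f x)"
    using is_generator_quadrature[OF gen] by metis
  have lead: "lead_coeff p = 1" and r: "?r \<le> n"
    and rec: "\<And>k. k \<le> 2 * n - ?r \<Longrightarrow> riesz w (monom 1 k * p) = 0"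
    using gen by (auto simp: is_generator_def)
  have "poly p 0 \<noteq> 0" using p0 by (simp add: poly_0_coeff_0)
  then have X0: "0 \<notin> X" using X(1) unfolding X(2) by (auto simp: poly_prod prod_zero_iff)
  have card: "card X = ?r" using X(1,2) by (simp add: prod_linear_poly)
  have w: "w j = (\<Sum>x\<in>X. \<rho> x * x ^ j)" if "j \<le> 2 * n" for j
    using quad[of "monom 1 j"] that by (simp add: monom_in_polys_below riesz_monom poly_monom)
  have "is_generator ?w' n (\<Prod>y\<in>inverse ` X. [:- y, 1:])"
  proof (rule atomic_is_generator)
    show "card (inverse ` X) \<le> n" using card_image_le[OF X(1), of inverse] card r by simp
    show "0 < \<rho> (inverse y) * inverse y ^ (2 * n)" if "y \<in> inverse ` X" for y
      using that X(3) X0 by (auto intro!: mult_pos_pos simp: zero_less_power_eq)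
    show "w (2 * n - j) = (\<Sum>y\<in>inverse ` X. \<rho> (inverse y) * inverse y ^ (2 * n) * y ^ j)"
      if "j \<le> 2 * n" for j
      using X(1) X0 w that by (rule atomic_reverse)
  qed (use X in simp)
  then have rank: "seq_rank ?w' n = ?r"
    using X(1) card by (simp add: is_generator_seq_rank prod_linear_poly card_image inj_on_def)
  have pd: "pd_mat (hank w (2 * (n + 1 - ?r)) ?r)"
    unfolding pd_hank_iff
  proof (intro ballI impI)
    fix q assume q: "q \<in> polys_below ?r" "q \<noteq> 0"
    \<comment> \<open>A_w[r-1] has the even offset 2m, so its form at q is L((x^m q)^2), of degree
      at most 2m + 2(r - 1) = 2n.\<close>
    define m where "m = n + 1 - ?r"
    have "degree (monom 1 (2 * m) * (q * q)) \<le> 2 * n"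
      using q r degree_mult_le[of "monom 1 (2 * m)" "q * q"] degree_mult_le[of q q]
      by (auto simp: polys_below_iff degree_monom_eq m_def)
    then have eq: "riesz w (monom 1 (2 * m) * (q * q)) = (\<Sum>x\<in>X. \<rho> x * (x ^ m * poly q x)\<^sup>2)"
      by (simp add: quad polys_below_Suc_iff poly_monom power2_eq_square power_mult mult_ac)
    have "\<exists>x\<in>X. poly q x \<noteq> 0"
      using poly_eqI_degree[of X q 0] q card by (auto simp: polys_below_iff)
    then obtain x where x: "x \<in> X" "poly q x \<noteq> 0" by blast
    then have "x \<noteq> 0" using X0 by auto
    show "0 < riesz w (monom 1 (2 * (n + 1 - ?r)) * (q * q))"
      unfolding m_def[symmetric] eq
    proof (rule sum_pos2[OF X(1) x(1)])
      show "0 < \<rho> x * (x ^ m * poly q x)\<^sup>2" using X(3)[OF x(1)] x(2) \<open>x \<noteq> 0\<close> by simp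
      show "0 \<le> \<rho> y * (y ^ m * poly q y)\<^sup>2" if "y \<in> X" for y using X(3)[OF that] by simp
    qed
  qed
  define \<psi> where "\<psi> = vec ?r (\<lambda>i. - coeff p (Suc i) / coeff p 0)"
  have rec': "w k = (\<Sum>i<?r. \<psi> $ i * w (k + 1 + i))" if "k \<le> 2 * n - ?r" for k
  proof -
    have "0 = (\<Sum>i<Suc ?r. coeff p i * w (k + i))"
      using rec[OF that] riesz_monom_mult_sum[of "{..<Suc ?r}" p w k] by (auto simp: coeff_eq_0)
    also have "\<dots> = coeff p 0 * w k + (\<Sum>i<?r. coeff p (Suc i) * w (k + Suc i))"
      by (subst sum.lessThan_Suc_shift) simp
    finally have "coeff p 0 * w k = - (\<Sum>i<?r. coeff p (Suc i) * w (k + Suc i))" by simp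
    then have "w k = - (\<Sum>i<?r. coeff p (Suc i) * w (k + Suc i)) / coeff p 0"
      using p0 by (simp add: field_simps)
    then show ?thesis by (simp add: \<psi>_def sum_divide_distrib flip: sum_negf)
  qed
  have psi: "inv_mat (hank w (2 * (n + 1 - ?r)) ?r) *\<^sub>v vec ?r (\<lambda>i. w (2 * n - 2 * ?r + 1 + i)) = \<psi>"
  proof (subst inv_mat_mult_vec_eq_iff[OF hank_carrier pd_mat_det_nonzero[OF hank_carrier pd]])
    show "hank w (2 * (n + 1 - ?r)) ?r *\<^sub>v \<psi> = vec ?r (\<lambda>i. w (2 * n - 2 * ?r + 1 + i))"
    proof (intro eq_vecI)
      fix i assume "i < dim_vec (vec ?r (\<lambda>i. w (2 * n - 2 * ?r + 1 + i)))"
      then have i: "i < ?r" by simp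
      \<comment> \<open>The offset is two more than 2n - 2r: one step is the right-hand side's start
        at 2n - 2r + 1, the other the shift k + 1 in the backward recurrence.\<close>
      have "2 * (n + 1 - ?r) = 2 * n - 2 * ?r + 1 + 1" using r by simp
      then have "(hank w (2 * (n + 1 - ?r)) ?r *\<^sub>v \<psi>) $ i =
          (\<Sum>j<?r. w (2 * n - 2 * ?r + 1 + i + 1 + j) * \<psi> $ j)"
        using i by (simp add: hank_def scalar_prod_def \<psi>_def atLeast0LessThan add_ac)
      also have "\<dots> = w (2 * n - 2 * ?r + 1 + i)"
        using rec'[of "2 * n - 2 * ?r + 1 + i"] i r by (simp add: mult.commute)
      finally show "(hank w (2 * (n + 1 - ?r)) ?r *\<^sub>v \<psi>) $ i =
          vec ?r (\<lambda>i. w (2 * n - 2 * ?r + 1 + i)) $ i" using i by simp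
    qed simp
  qed (simp_all add: \<psi>_def)
  have "w (2 * n - ?r - j) = (\<Sum>i<?r. \<psi> $ i * w (2 * n - ?r + 1 - j + i))"
    if "j \<in> {0..2 * n - ?r}" for j
    using rec'[of "2 * n - ?r - j"] that by (simp add: Suc_diff_le)
  then show ?thesis
    unfolding nrg_def rank Let_def psi using pd by blast
qed

text \<open>The candidate is a monic kernel polynomial p of least degree r. The kernel yields L(x^k
  p) = 0 for k \<le> n only; the remaining relations follow once x^(n-r) p is known to lie in the
  kernel too.\<close>

lemma psd_flat_is_generator:
  assumes psd: "psd_mat (hank w 0 (Suc n))"
    and e: "e \<in> hank_kernel w 0 (Suc n)" "e \<noteq> 0" "degree e = n"
    and f: "f \<in> hank_kernel w 0 (Suc n)" "coeff f 0 \<noteq> 0"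
  shows "\<exists>p. is_generator w n p \<and> coeff p 0 \<noteq> 0"
proof -
  let ?K = "hank_kernel w 0 (Suc n)"
  have K: "g \<in> ?K \<longleftrightarrow> g \<in> polys_below (Suc n) \<and> riesz w (g * g) = 0" for g
    using psd_hank_kernel_iff[OF psd] by simp
  have K_mult: "riesz w (h * g) = 0" if "g \<in> ?K" "h \<in> polys_below (Suc n)" for g h
    by (rule riesz_mult_eq_0[of n]) (use that in \<open>auto simp: hank_kernel_def\<close>)
  obtain p where p: "p \<in> ?K" "lead_coeff p = 1"
    and least: "\<And>g. g \<in> ?K \<Longrightarrow> g \<noteq> 0 \<Longrightarrow> degree p \<le> degree g"
    using hank_kernel_least[OF e(1,2)] by metis
  let ?r = "degree p"
  have p0: "p \<noteq> 0" using p(2) by auto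
  have r: "?r \<le> n" using p(1) by (simp add: K polys_below_Suc_iff)
  have pos: "riesz w (q * q) > 0" if "q \<in> polys_below ?r" "q \<noteq> 0" for q
  proof -
    have q: "q \<in> polys_below (Suc n)" using that(1) r by (auto intro: polys_below_mono[of q ?r])
    then have "riesz w (q * q) \<ge> 0" using psd by (simp add: psd_hank_iff)
    moreover have "riesz w (q * q) \<noteq> 0" using least[of q] that q by (auto simp: K polys_below_iff)
    ultimately show ?thesis by simp
  qed
  \<comment> \<open>If g has degree at most n - 2, then x^2 g still has degree at most n and L((x
    g)^2) = L(x^2 g g) = 0, so x g is isotropic. This stops at degree n - 1.\<close>
  have shift: "monom 1 1 * g \<in> ?K" if g: "g \<in> ?K" "g \<in> polys_below (n - 1)" for g
  proof -
    have "monom 1 2 * g \<in> polys_below (Suc n)" "monom 1 1 * g \<in> polys_below (Suc n)"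
      using g(2) polys_below_mono[OF polys_below_monom_mult[OF g(2), of 2], of "Suc n"]
        polys_below_mono[OF polys_below_monom_mult[OF g(2), of 1], of "Suc n"]
      by (cases n; simp add: zero_in_polys_below)+
    moreover have "(monom 1 1 * g) * (monom 1 1 * g) = (monom 1 2 * g) * g"
      by (simp add: poly_monom power2_eq_square fun_eq_iff flip: poly_eq_poly_eq_iff)
    ultimately show ?thesis using K_mult[OF g(1)] by (simp only: K)
  qed
  have mult: "monom 1 k * p \<in> ?K" if "?r + k < n \<or> k = 0" for k
    using that
  proof (induction k)
    case 0
    then show ?case using p(1) by (simp add: monom_0 flip: one_pCons)
  next
    case (Suc k)
    then have "monom 1 k * p \<in> ?K" by auto
    moreover have "monom 1 k * p \<in> polys_below (n - 1)"
      using Suc.prems polys_below_monom_mult[of p "Suc ?r" k]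
        polys_below_mono[of "monom 1 k * p" "k + Suc ?r" "n - 1"]
      by (simp add: polys_below_Suc_iff)
    ultimately have "monom 1 1 * (monom 1 k * p) \<in> ?K" by (rule shift)
    then show ?case by (simp add: mult_monom flip: mult.assoc)
  qed
  \<comment> \<open>The step into degree n is where e enters. With h the monic multiple of e,
    x^(n-r) p - h has degree below n and is orthogonal to 1, ..., x^(n-1), the first part because
    x^j x^(n-r) p = x^(j+1) x^(n-1-r) p. So it is isotropic, and adding h back stays in the
    kernel.\<close>
  have last: "monom 1 (n - ?r) * p \<in> ?K"
  proof (cases "?r = n")
    case True
    then show ?thesis using mult[of 0] by simp
  next
    case False
    define g where "g = monom 1 (n - ?r) * p"
    define h where "h = Polynomial.smult (1 / lead_coeff e) e"
    have h: "h \<in> ?K" "coeff h n = 1" "degree h = n"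
      using e by (auto simp: h_def hank_kernel_smult)
    have deg_g: "degree g = n" using p0 r by (simp add: g_def degree_mult_eq degree_monom_eq monom_eq_0_iff)
    have "coeff g n = 1" using p(2) r by (simp add: g_def coeff_monom_mult)
    then have "coeff (g - h) i = 0" if "i \<ge> n" for i
      using that h deg_g by (cases "i = n") (auto simp: coeff_eq_0)
    then have s: "g - h \<in> polys_below n" by (simp add: polys_below_def)
    have "riesz w (monom 1 j * (g - h)) = 0" if "j \<le> n - 1" for j
    proof -
      have j: "j + 1 \<le> n" using that False r by simp
      have "monom 1 j * g = monom 1 (j + 1) * (monom 1 (n - 1 - ?r) * p)"
      proof -
        have "j + (n - ?r) = j + 1 + (n - 1 - ?r)" using False r by simp
        then show ?thesis by (simp only: g_def mult_monom mult.assoc[symmetric] mult_1)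
      qed
      moreover have "monom 1 (n - 1 - ?r) * p \<in> ?K" using False r by (intro mult) auto
      ultimately have "riesz w (monom 1 j * g) = 0"
        using K_mult[of "monom 1 (n - 1 - ?r) * p" "monom 1 (j + 1)"] j
        by (simp add: monom_in_polys_below)
      moreover have "riesz w (monom 1 j * h) = 0"
        using K_mult[OF h(1), of "monom 1 j"] j by (simp add: monom_in_polys_below)
      ultimately show ?thesis by (simp add: right_diff_distrib riesz_diff)
    qed
    then have "riesz w ((g - h) * (g - h)) = 0"
      by (rule riesz_mult_eq_0[of "n - 1"]) (use s False r in auto)
    then have "g - h \<in> ?K" using polys_below_mono[OF s] by (simp add: K)
    from hank_kernel_add[OF this h(1)] show ?thesis by (simp add: g_def)
  qed
  have rec: "riesz w (monom 1 k * p) = 0" if "k \<le> 2 * n - ?r" for k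
  proof (cases "k \<le> n")
    case True
    then show ?thesis using K_mult[OF p(1), of "monom 1 k"] by (simp add: monom_in_polys_below)
  next
    case False
    then have eq: "monom 1 k * p = monom 1 (k - (n - ?r)) * (monom 1 (n - ?r) * p)"
      using r by (simp add: mult_monom flip: mult.assoc)
    show ?thesis
      unfolding eq using that False r by (intro K_mult[OF last] monom_in_polys_below) simp
  qed
  with p(2) r pos have gen: "is_generator w n p" by (simp add: is_generator_def)
  \<comment> \<open>The multiple of p in the division of f lies in the kernel, hence so does
    \<open>f mod p\<close>, which is 0 by minimality. Thus p divides f, and p(0) = 0 would give f(0)
    = 0.\<close>
  have "coeff p 0 \<noteq> 0"
  proof
    assume zero: "coeff p 0 = 0"
    have fb: "f \<in> polys_below (Suc n)" using f(1) by (simp add: K)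
    have div: "f div p \<in> polys_below (Suc (n - ?r))"
      using poly_div_in_polys_below[OF p0, of f "Suc (n - ?r)"] fb r by simp
    have "riesz w (monom 1 j * (f div p * p)) = 0" if "j \<le> n" for j
    proof -
      have "monom 1 j * (f div p) \<in> polys_below (Suc (2 * n - ?r))"
        using polys_below_mono[OF polys_below_monom_mult[OF div, of j], of "Suc (2 * n - ?r)"] that r
        by simp
      then have "riesz w (monom 1 j * (f div p) * p) = 0" by (rule is_generator_mult[OF gen])
      then show ?thesis by (simp only: mult.assoc)
    qed
    moreover have "f div p * p \<in> polys_below (Suc n)"
      using polys_below_mult[OF div, of p "Suc ?r"] r by (simp add: polys_below_Suc_iff)
    ultimately have "f div p * p \<in> ?K" by (simp add: hank_kernel_def)
    then have "f - f div p * p \<in> ?K" by (rule hank_kernel_diff[OF f(1)])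
    then have "f mod p \<in> ?K" by (simp add: minus_div_mult_eq_mod)
    then have "f mod p = 0" using least[of "f mod p"] degree_mod_less[OF p0, of f] by (metis not_le)
    then have "f = f div p * p" by (metis add.right_neutral div_mult_mod_eq)
    then have "coeff f 0 = coeff (f div p) 0 * coeff p 0" by (metis coeff_mult_0)
    with zero f(2) show False by simp
  qed
  with gen show ?thesis by blast
qed

subsection \<open>Representing measures\<close>

lemma borel_measurable_power_int [measurable]: "(\<lambda>x::real. x powi i) \<in> borel_measurable borel"
proof (cases "i \<ge> 0")
  case True
  then show ?thesis by (simp add: power_int_def)
next
  case False
  then show ?thesis by (simp add: power_int_def)
qed

lemma borel_measurable_poly [measurable]: "(\<lambda>x::real. poly p x) \<in> borel_measurable borel"
  by (intro borel_measurable_continuous_onI continuous_on_poly continuous_on_id)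

lemma power_int_neg_even:
  fixes x :: real
  shows "x powi (- 2 * int k) = (inverse (x ^ k))\<^sup>2"
proof -
  have "x powi (- 2 * int k) = inverse (x powi int (2 * k))"
    by (simp flip: power_int_minus)
  also have "\<dots> = inverse (x ^ (2 * k))" by (simp only: power_int_of_nat)
  also have "\<dots> = (inverse (x ^ k))\<^sup>2" by (simp add: power_inverse power_mult[of x k 2] mult.commute[of 2])
  finally show ?thesis .
qed

text \<open>Raising the lower index by one shifts rows and columns alike, hence the offset
  2.\<close>

lemma Mb_eq_hank:
  "Mb \<beta> (- int k1) (int k2) = hank (wseq k1 \<beta>) 0 (Suc (k1 + k2))"
  "Mb \<beta> (- int k1) (int k2 - 1) = hank (wseq k1 \<beta>) 0 (k1 + k2)"
  "Mb \<beta> (- int k1 + 1) (int k2) = hank (wseq k1 \<beta>) 2 (k1 + k2)"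
proof -
  have "nat (int k2 - - int k1 + 1) = Suc (k1 + k2)" "nat (int k2 - 1 - - int k1 + 1) = k1 + k2"
    "nat (int k2 - (- int k1 + 1) + 1) = k1 + k2"
    by simp_all
  then show "Mb \<beta> (- int k1) (int k2) = hank (wseq k1 \<beta>) 0 (Suc (k1 + k2))"
    "Mb \<beta> (- int k1) (int k2 - 1) = hank (wseq k1 \<beta>) 0 (k1 + k2)"
    "Mb \<beta> (- int k1 + 1) (int k2) = hank (wseq k1 \<beta>) 2 (k1 + k2)"
    unfolding Mb_def hank_def wseq_def
    by (auto intro!: cong_mat arg_cong[where f = \<beta>])
qed

lemma rep_measure_AE_nonzero:
  assumes "rep_measure k1 k2 \<beta> M"
  shows "AE x in M. x \<noteq> 0"
proof (rule AE_I)
  show "emeasure M {0} = 0" "{0} \<in> sets M" using assms by (auto simp: rep_measure_def)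
qed auto

lemma rep_measure_sets:
  assumes "rep_measure k1 k2 \<beta> M"
  shows "sets M = sets borel"
  using assms by (simp add: rep_measure_def)

text \<open>L is integration against x^(-2 k1) d\<mu>.\<close>

lemma rep_measure_riesz:
  assumes rep: "rep_measure k1 k2 \<beta> M" and f: "f \<in> polys_below (Suc (2 * (k1 + k2)))"
  shows "integrable M (\<lambda>x. poly f x * x powi (- 2 * int k1))"
    and "(\<integral>x. poly f x * x powi (- 2 * int k1) \<partial>M) = riesz (wseq k1 \<beta>) f"
proof -
  let ?n = "k1 + k2"
  let ?h = "\<lambda>x. \<Sum>i\<le>2 * ?n. coeff f i * x powi (int i - 2 * int k1)"
  have mom: "integrable M (\<lambda>x. x powi (int i - 2 * int k1))"
    "(\<integral>x. x powi (int i - 2 * int k1) \<partial>M) = wseq k1 \<beta> i" if "i \<le> 2 * ?n" for i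
    using rep that by (auto simp: rep_measure_def wseq_def)
  have int: "integrable M ?h"
    using mom by (intro Bochner_Integration.integrable_sum integrable_mult_right) auto
  have "(\<integral>x. ?h x \<partial>M) = (\<Sum>i\<le>2 * ?n. \<integral>x. coeff f i * x powi (int i - 2 * int k1) \<partial>M)"
    using mom by (intro Bochner_Integration.integral_sum integrable_mult_right) auto
  also have "\<dots> = (\<Sum>i\<le>2 * ?n. coeff f i * wseq k1 \<beta> i)"
    using mom by (intro sum.cong) auto
  also have "\<dots> = riesz (wseq k1 \<beta>) f"
    using f by (intro riesz_eq_sum[symmetric]) (auto simp: polys_below_def)
  finally have val: "(\<integral>x. ?h x \<partial>M) = riesz (wseq k1 \<beta>) f" .
  \<comment> \<open>At x = 0 the exponents need not add up, because \<open>powi\<close> sends 0 to 0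
    for negative exponents and to 1 for exponent 0; the point is a null set.\<close>
  have "?h x = poly f x * x powi (- 2 * int k1)" if "x \<noteq> 0" for x
  proof -
    have "poly f x = (\<Sum>i\<le>2 * ?n. coeff f i * x ^ i)"
      using f unfolding poly_altdef
      by (intro sum.mono_neutral_left) (auto simp: polys_below_Suc_iff coeff_eq_0)
    moreover have "x powi (int i - 2 * int k1) = x ^ i * x powi (- 2 * int k1)" for i
      using power_int_add[of x "int i" "- 2 * int k1"] that by simp
    ultimately show ?thesis by (simp add: sum_distrib_right mult.assoc)
  qed
  then have AE: "AE x in M. ?h x = poly f x * x powi (- 2 * int k1)"
    using rep_measure_AE_nonzero[OF rep] by auto
  have meas: "(\<lambda>x. poly f x * x powi (- 2 * int k1)) \<in> borel_measurable M"
    unfolding measurable_cong_sets[OF rep_measure_sets[OF rep] refl] by measurable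
  show "integrable M (\<lambda>x. poly f x * x powi (- 2 * int k1))"
    using int meas AE by (rule integrable_cong_AE_imp)
  have "(\<integral>x. poly f x * x powi (- 2 * int k1) \<partial>M) = (\<integral>x. ?h x \<partial>M)"
    using AE by (intro integral_cong_AE meas borel_measurable_integrable[OF int]) auto
  with val show "(\<integral>x. poly f x * x powi (- 2 * int k1) \<partial>M) = riesz (wseq k1 \<beta>) f" by simp
qed

text \<open>The weight x^(-2 k1) is a square and nonzero off 0, so L(q^2) = 0 forces q to vanish
  \<mu>-almost everywhere.\<close>

lemma rep_measure_riesz_square:
  assumes rep: "rep_measure k1 k2 \<beta> M" and q: "q \<in> polys_below (Suc (k1 + k2))"
  shows "riesz (wseq k1 \<beta>) (q * q) \<ge> 0"
    and "riesz (wseq k1 \<beta>) (q * q) = 0 \<Longrightarrow> AE x in M. poly q x = 0"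
proof -
  let ?h = "\<lambda>x. poly (q * q) x * x powi (- 2 * int k1)"
  have qq: "q * q \<in> polys_below (Suc (2 * (k1 + k2)))"
  proof -
    have "Suc (2 * (k1 + k2)) = k1 + k2 + Suc (k1 + k2)" by simp
    then show ?thesis using polys_below_mult[OF q q] by (simp only:)
  qed
  have nonneg: "?h x \<ge> 0" for x
    unfolding power_int_neg_even poly_mult by simp
  show "riesz (wseq k1 \<beta>) (q * q) \<ge> 0"
    unfolding rep_measure_riesz(2)[OF rep qq, symmetric] by (intro integral_nonneg_AE AE_I2 nonneg)
  assume "riesz (wseq k1 \<beta>) (q * q) = 0"
  then have "AE x in M. ?h x = 0"
    using integral_nonneg_eq_0_iff_AE[OF rep_measure_riesz(1)[OF rep qq]] nonneg
      rep_measure_riesz(2)[OF rep qq] by simp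
  then show "AE x in M. poly q x = 0"
    using rep_measure_AE_nonzero[OF rep] by eventually_elim auto
qed

lemma rep_measure_psd:
  assumes "rep_measure k1 k2 \<beta> M"
  shows "psd_mat (hank (wseq k1 \<beta>) 0 (Suc (k1 + k2)))"
  using rep_measure_riesz_square(1)[OF assms] by (simp add: psd_hank_iff)

text \<open>A kernel polynomial p of least degree vanishes almost everywhere, and so does every
  multiple of it; this gives all recurrences up to degree 2n at once.\<close>

lemma rep_measure_is_generator:
  assumes rep: "rep_measure k1 k2 \<beta> M"
    and e: "e \<in> hank_kernel (wseq k1 \<beta>) 0 (Suc (k1 + k2))" "e \<noteq> 0"
  shows "\<exists>p. is_generator (wseq k1 \<beta>) (k1 + k2) p \<and> coeff p 0 \<noteq> 0"
proof -
  let ?w = "wseq k1 \<beta>" and ?n = "k1 + k2"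
  let ?K = "hank_kernel ?w 0 (Suc ?n)"
  have K: "g \<in> ?K \<longleftrightarrow> g \<in> polys_below (Suc ?n) \<and> riesz ?w (g * g) = 0" for g
    using psd_hank_kernel_iff[OF rep_measure_psd[OF rep]] by simp
  obtain p where p: "p \<in> ?K" "lead_coeff p = 1"
    and least: "\<And>g. g \<in> ?K \<Longrightarrow> g \<noteq> 0 \<Longrightarrow> degree p \<le> degree g"
    using hank_kernel_least[OF e] by metis
  have r: "degree p \<le> ?n" using p(1) by (simp add: K polys_below_Suc_iff)
  have AE: "AE x in M. poly p x = 0"
    using p(1) rep_measure_riesz_square(2)[OF rep] by (simp add: K)
  have zero: "riesz ?w f = 0"
    if "f \<in> polys_below (Suc (2 * ?n))" "AE x in M. poly f x = 0" for f
  proof -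
    have "AE x in M. poly f x * x powi (- 2 * int k1) = 0"
      using that(2) by eventually_elim simp
    then have "(\<integral>x. poly f x * x powi (- 2 * int k1) \<partial>M) = 0" by (rule integral_eq_zero_AE)
    then show ?thesis using rep_measure_riesz(2)[OF rep that(1)] by simp
  qed
  have rec: "riesz ?w (monom 1 k * p) = 0" if "k \<le> 2 * ?n - degree p" for k
  proof (rule zero)
    show "monom 1 k * p \<in> polys_below (Suc (2 * ?n))"
      by (rule polys_below_mono[OF polys_below_monom_mult[of p "Suc (degree p)"]])
        (use that r in \<open>auto simp: polys_below_Suc_iff\<close>)
    show "AE x in M. poly (monom 1 k * p) x = 0" using AE by eventually_elim simp
  qed
  have pos: "riesz ?w (q * q) > 0" if q: "q \<in> polys_below (degree p)" "q \<noteq> 0" for q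
  proof -
    have qb: "q \<in> polys_below (Suc ?n)" by (rule polys_below_mono[OF q(1)]) (use r in simp)
    have "riesz ?w (q * q) \<noteq> 0"
    proof
      assume "riesz ?w (q * q) = 0"
      then have "degree p \<le> degree q" using qb q(2) by (intro least) (simp_all add: K)
      with q show False by (simp add: polys_below_iff)
    qed
    with rep_measure_riesz_square(1)[OF rep qb] show ?thesis by simp
  qed
  \<comment> \<open>If p = x q, then q vanishes almost everywhere as well, because {0} is null. This
    contradicts positivity below the degree of p.\<close>
  have "coeff p 0 \<noteq> 0"
  proof
    assume c: "coeff p 0 = 0"
    define q where "q = poly_shift 1 p"
    have pq: "p = monom 1 1 * q"
      using c by (intro poly_eqI) (auto simp: q_def coeff_monom_mult coeff_poly_shift)
    have q0: "q \<noteq> 0" using p(2) pq by auto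
    have "degree p = Suc (degree q)"
      using q0 unfolding pq by (simp add: degree_mult_eq degree_monom_eq monom_eq_0_iff)
    then have "q \<in> polys_below (degree p)" by (simp add: polys_below_iff)
    then have "riesz ?w (q * q) > 0" using q0 by (rule pos)
    moreover have "riesz ?w (q * q) = 0"
    proof (rule zero)
      show "q * q \<in> polys_below (Suc (2 * ?n))"
        using \<open>degree p = Suc (degree q)\<close> r degree_mult_le[of q q] by (simp add: polys_below_Suc_iff)
      show "AE x in M. poly (q * q) x = 0"
        using AE rep_measure_AE_nonzero[OF rep] by eventually_elim (auto simp: pq poly_monom)
    qed
    ultimately show False by simp
  qed
  moreover have "is_generator ?w ?n p" using p(2) r rec pos by (simp add: is_generator_def)
  ultimately show ?thesis by blast
qed

section \<open>Discrete measures and the measure of a generator\<close>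

lemma discrete_measure_exists:
  assumes X: "finite X" "\<And>x. x \<in> X \<Longrightarrow> \<rho> x > 0"
  shows "\<exists>M. sets M = sets borel \<and> discrete_measure_on M X \<rho>"
proof -
  let ?N = "point_measure X (\<lambda>x. ennreal (\<rho> x))"
  let ?M = "distr ?N borel (\<lambda>x. x)"
  have meas: "(\<lambda>x. x) \<in> measurable ?N borel" by (simp add: measurable_def sets_point_measure space_point_measure)
  have "emeasure ?M A = (\<Sum>x\<in>X \<inter> A. ennreal (\<rho> x))" if "A \<in> sets ?M" for A
  proof -
    have "emeasure ?M A = emeasure ?N (A \<inter> X)"
      using that by (simp add: emeasure_distr[OF meas] space_point_measure)
    then show ?thesis using X(1) by (simp add: emeasure_point_measure_finite Int_commute)
  qed
  then have "discrete_measure_on ?M X \<rho>" using X by (simp add: discrete_measure_on_def)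
  then show ?thesis by (intro exI[of _ ?M]) simp
qed

lemma discrete_measure_on_unique:
  assumes "sets M = sets N" "discrete_measure_on M X \<rho>" "discrete_measure_on N X \<rho>"
  shows "M = N"
  using assms by (intro measure_eqI) (auto simp: discrete_measure_on_def)

text \<open>The prescribed values on Borel sets identify M with the push-forward of a point measure
  on X, whose integrals are finite sums.\<close>

lemma discrete_measure_on_integral:
  assumes M: "sets M = sets borel" "discrete_measure_on M X \<rho>"
    and f [measurable]: "f \<in> borel_measurable borel"
  shows "integrable M f" "(\<integral>x. f x \<partial>M) = (\<Sum>x\<in>X. \<rho> x * (f x :: real))"
proof -
  let ?N = "point_measure X (\<lambda>x. ennreal (\<rho> x))"
  have X: "finite X" "\<And>x. x \<in> X \<Longrightarrow> \<rho> x > 0" using M(2) by (auto simp: discrete_measure_on_def)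
  have meas: "(\<lambda>x. x) \<in> measurable ?N borel" by (simp add: measurable_def sets_point_measure space_point_measure)
  have eq: "M = distr ?N borel (\<lambda>x. x)"
  proof (rule measure_eqI)
    fix A assume A: "A \<in> sets M"
    then have "emeasure (distr ?N borel (\<lambda>x. x)) A = emeasure ?N (A \<inter> X)"
      using M(1) by (simp add: emeasure_distr[OF meas] space_point_measure)
    also have "\<dots> = (\<Sum>x\<in>X \<inter> A. ennreal (\<rho> x))"
      using X(1) by (simp add: emeasure_point_measure_finite Int_commute)
    finally show "emeasure M A = emeasure (distr ?N borel (\<lambda>x. x)) A"
      using M(2) A by (simp add: discrete_measure_on_def)
  qed (use M in simp)
  have "integrable ?N f"
    using X(1) by (intro integrable_point_measure_finite)
  then show "integrable M f" unfolding eq by (simp add: integrable_distr_eq[OF meas])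
  have "(\<integral>x. f x \<partial>M) = (\<integral>x. f x \<partial>?N)" unfolding eq by (rule integral_distr[OF meas f])
  also have "\<dots> = (\<Sum>x\<in>X. \<rho> x * f x)"
    using X by (subst lebesgue_integral_point_measure_finite) (auto intro: less_imp_le)
  finally show "(\<integral>x. f x \<partial>M) = (\<Sum>x\<in>X. \<rho> x * f x)" .
qed

lemma discrete_rep_measureI:
  assumes M: "sets M = sets borel" "discrete_measure_on M X \<rho>" and X0: "0 \<notin> X"
    and \<beta>: "\<And>i. i \<in> {- 2 * int k1..2 * int k2} \<Longrightarrow> \<beta> i = (\<Sum>x\<in>X. \<rho> x * x powi i)"
  shows "rep_measure k1 k2 \<beta> M"
  using assms discrete_measure_on_integral[OF M borel_measurable_power_int]
  by (auto simp: rep_measure_def discrete_measure_on_def)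

lemma wseq_atomic:
  assumes "0 \<notin> X" "\<beta> (int j - 2 * int k1) = (\<Sum>x\<in>X. \<rho> x * x powi (int j - 2 * int k1))"
  shows "wseq k1 \<beta> j = (\<Sum>x\<in>X. (\<rho> x * x powi (- 2 * int k1)) * x ^ j)"
proof -
  have "x powi (int j - 2 * int k1) = x powi (- 2 * int k1) * x ^ j" if "x \<in> X" for x
    using power_int_add[of x "int j" "- 2 * int k1"] that assms(1) by (auto simp: mult.commute)
  then show ?thesis using assms(2) by (simp add: wseq_def mult.assoc cong: sum.cong)
qed

lemma is_generator_rep_measure_exists:
  assumes gen: "is_generator (wseq k1 \<beta>) (k1 + k2) p" and p0: "coeff p 0 \<noteq> 0"
  shows "\<exists>M. rep_measure k1 k2 \<beta> M"
proof -
  let ?w = "wseq k1 \<beta>" and ?n = "k1 + k2"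
  obtain X \<rho> where X: "finite X" "p = (\<Prod>x\<in>X. [:- x, 1:])" "\<And>x. x \<in> X \<Longrightarrow> \<rho> x > 0"
    and quad: "\<And>f. f \<in> polys_below (Suc (2 * ?n)) \<Longrightarrow> riesz ?w f = (\<Sum>x\<in>X. \<rho> x * poly f x)"
    using is_generator_quadrature[OF gen] by metis
  have "poly p 0 \<noteq> 0" using p0 by (simp add: poly_0_coeff_0)
  then have X0: "0 \<notin> X" using X(1) unfolding X(2) by (auto simp: poly_prod prod_zero_iff)
  have nz: "x \<noteq> 0" if "x \<in> X" for x using that X0 by auto
  \<comment> \<open>The quadrature weights belong to x^(-2 k1) d\<mu>; the factor x^(2 k1) undoes
    this density and is positive since 0 is not a node.\<close>
  let ?\<rho> = "\<lambda>x. \<rho> x * x ^ (2 * k1)"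
  have "?\<rho> x > 0" if "x \<in> X" for x
    using X(3)[OF that] nz[OF that] by (simp add: power_mult)
  then obtain M where M: "sets M = sets borel" "discrete_measure_on M X ?\<rho>"
    using discrete_measure_exists[OF X(1), of ?\<rho>] by blast
  have "rep_measure k1 k2 \<beta> M"
  proof (rule discrete_rep_measureI[OF M X0])
    fix i assume i: "i \<in> {- 2 * int k1..2 * int k2}"
    define j where "j = nat (i + 2 * int k1)"
    have ij: "i = int j - 2 * int k1" and j: "j \<le> 2 * ?n" using i by (auto simp: j_def)
    have "\<beta> i = ?w j" by (simp add: wseq_def ij)
    also have "\<dots> = (\<Sum>x\<in>X. \<rho> x * x ^ j)"
      using quad[of "monom 1 j"] j by (simp add: monom_in_polys_below riesz_monom poly_monom)
    also have "\<dots> = (\<Sum>x\<in>X. ?\<rho> x * x powi i)"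
    proof (intro sum.cong refl)
      fix x assume "x \<in> X"
      then have "x powi int j = x powi int (2 * k1) * x powi i"
        using nz by (simp add: ij flip: power_int_add)
      then show "\<rho> x * x ^ j = ?\<rho> x * x powi i" by (simp only: power_int_of_nat mult.assoc)
    qed
    finally show "\<beta> i = (\<Sum>x\<in>X. ?\<rho> x * x powi i)" .
  qed
  then show ?thesis by blast
qed

text \<open>The weights are written in terms of w and p alone, so that they are visibly the same for
  any two representing measures.\<close>

lemma is_generator_rep_measure_discrete:
  assumes gen: "is_generator (wseq k1 \<beta>) (k1 + k2) p" and rep: "rep_measure k1 k2 \<beta> M"
  defines "X \<equiv> {x. poly p x = 0}"
  shows "card X = degree p"
    and "discrete_measure_on M X (\<lambda>c. c ^ (2 * k1) * riesz (wseq k1 \<beta>) (lagrange_basis X c))"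
proof -
  let ?w = "wseq k1 \<beta>" and ?n = "k1 + k2"
  obtain Y \<rho> where Y: "finite Y" "p = (\<Prod>x\<in>Y. [:- x, 1:])" "\<And>x. x \<in> Y \<Longrightarrow> \<rho> x > 0"
    and quad: "\<And>f. f \<in> polys_below (Suc (2 * ?n)) \<Longrightarrow> riesz ?w f = (\<Sum>x\<in>Y. \<rho> x * poly f x)"
    using is_generator_quadrature[OF gen] by metis
  have YX: "Y = X" using prod_linear_poly(3)[OF Y(1)] Y(2) by (simp add: X_def)
  note X = Y[unfolded YX] and quad = quad[unfolded YX]
  show card: "card X = degree p" using prod_linear_poly(1)[OF X(1)] X(2) by simp
  have r: "degree p \<le> ?n" using gen by (simp add: is_generator_def)
  have sets: "sets M = sets borel" using rep by (simp add: rep_measure_def)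
  have "p \<in> polys_below (Suc ?n)" "riesz ?w (p * p) = 0"
    using is_generator_in_kernel[OF gen] psd_hank_kernel_iff[OF rep_measure_psd[OF rep]] by auto
  then have AE: "AE x in M. x \<in> X"
    using rep_measure_riesz_square(2)[OF rep] by (simp add: X_def)
  interpret finite_measure M
  proof
    \<comment> \<open>The moment of order 0 is always among the prescribed ones, so M has finite
      mass.\<close>
    have "0 \<in> {- 2 * int k1..2 * int k2}" by simp
    then have "integrable M (\<lambda>x. x powi 0)" using rep unfolding rep_measure_def by blast
    then show "emeasure M (space M) \<noteq> \<infinity>" by (simp add: integrable_iff_bounded less_top)
  qed
  let ?\<sigma> = "\<lambda>c. c ^ (2 * k1) * riesz ?w (lagrange_basis X c)"
  have weight: "measure M {c} = ?\<sigma> c \<and> ?\<sigma> c > 0" if c: "c \<in> X" for c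
  proof -
    let ?l = "lagrange_basis X c"
    have "?l \<in> polys_below (degree p)" using lagrange_basis_in_polys_below[OF X(1) c] card by simp
    then have lb: "?l \<in> polys_below (Suc (2 * ?n))" by (rule polys_below_mono) (use r in simp)
    have "riesz ?w ?l = (\<Sum>x\<in>X. if x = c then \<rho> c else 0)"
      unfolding quad[OF lb] using poly_lagrange_basis[OF X(1) c] by (intro sum.cong) auto
    then have lpos: "riesz ?w ?l > 0" using X(1,3) c by simp
    \<comment> \<open>M lives on X, where the Lagrange polynomial of c is the indicator of {c};
      integrating it isolates the mass at c.\<close>
    have "AE x in M. poly ?l x * x powi (- 2 * int k1) = indicator {c} x * c powi (- 2 * int k1)"
      using AE by eventually_elim (use poly_lagrange_basis[OF X(1) c] in \<open>auto simp: indicator_def\<close>)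
    then have "(\<integral>x. poly ?l x * x powi (- 2 * int k1) \<partial>M)
        = (\<integral>x. indicator {c} x * c powi (- 2 * int k1) \<partial>M)"
      using sets by (intro integral_cong_AE) auto
    then have eq: "riesz ?w ?l = measure M {c} * c powi (- 2 * int k1)"
      using rep_measure_riesz(2)[OF rep lb] sets by simp
    \<comment> \<open>With c = 0 and k1 > 0 the factor \<open>c powi (- 2 * int k1)\<close> would be
      0, against L(l) > 0. In either remaining case c^(2 k1) > 0.\<close>
    then have "c \<noteq> 0 \<or> k1 = 0" using lpos unfolding power_int_neg_even
      by (auto simp: power_0_left split: if_splits)
    then have pow: "c ^ (2 * k1) > 0" by (auto simp: power_mult)
    have pw: "c powi (- 2 * int k1) = inverse (c ^ (2 * k1))"
      unfolding power_int_neg_even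
      by (simp add: power_inverse power_mult[of c k1 2] mult.commute[of 2])
    have "c ^ (2 * k1) * inverse (c ^ (2 * k1)) = 1" using pow by (metis right_inverse less_irrefl)
    then have "measure M {c} = ?\<sigma> c"
      unfolding eq pw by (metis mult.left_commute mult.right_neutral)
    then show ?thesis using pow lpos by simp
  qed
  have "emeasure M A = (\<Sum>x\<in>X \<inter> A. ennreal (?\<sigma> x))" if A: "A \<in> sets M" for A
  proof -
    have fin: "finite (X \<inter> A)" using X(1) by simp
    then have "X \<inter> A \<in> sets M" using sets by (simp add: finite_imp_closed borel_closed)
    then have "emeasure M A = emeasure M (X \<inter> A)"
      using AE A by (intro emeasure_eq_AE) auto
    also have "\<dots> = (\<Sum>x\<in>X \<inter> A. emeasure M {x})"
      using fin sets by (intro emeasure_eq_sum_singleton) auto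
    also have "\<dots> = (\<Sum>x\<in>X \<inter> A. ennreal (?\<sigma> x))"
      using weight by (intro sum.cong) (auto simp: emeasure_eq_measure)
    finally show ?thesis .
  qed
  then show "discrete_measure_on M X ?\<sigma>"
    using X(1) weight by (simp add: discrete_measure_on_def)
qed

lemma is_generator_rep_measure_unique:
  assumes "is_generator (wseq k1 \<beta>) (k1 + k2) p" "rep_measure k1 k2 \<beta> M" "rep_measure k1 k2 \<beta> N"
  shows "M = N"
  using is_generator_rep_measure_discrete(2)[OF assms(1,2)]
    is_generator_rep_measure_discrete(2)[OF assms(1,3)] assms(2,3)
  by (intro discrete_measure_on_unique) (auto simp: rep_measure_def)

subsection \<open>Flat extensions\<close>

lemma invertible_mat_iff_det_nonzero:
  fixes A :: "real mat"
  assumes A: "A \<in> carrier_mat n n"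
  shows "invertible_mat A \<longleftrightarrow> det A \<noteq> 0"
proof
  assume "invertible_mat A"
  then obtain B where B: "A * B = 1\<^sub>m (dim_row A)" "B * A = 1\<^sub>m (dim_row B)"
    by (auto simp: invertible_mat_def inverts_mat_def)
  have "dim_col (A * B) = n" "dim_col (B * A) = dim_row B" unfolding B using A by auto
  then have "B \<in> carrier_mat n n" using A by auto
  then have "det A * det B = det (1\<^sub>m n)" using det_mult[OF A] B(1) A by (metis carrier_matD(1))
  then have "det A * det B = 1" by simp
  then show "det A \<noteq> 0" by auto
next
  assume "det A \<noteq> 0"
  from inv_mat[OF A this] A show "invertible_mat A"
    by (auto simp: invertible_mat_def inverts_mat_def square_mat.simps)
qed

lemma riesz_monom_mult_vec:
  assumes "p \<in> polys_below s"
  shows "riesz w (monom 1 k * p) = vec s (\<lambda>i. w (k + i)) \<bullet> vec s (coeff p)"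
proof -
  have "riesz w (monom 1 k * p) = (\<Sum>i<s. coeff p i * w (k + i))"
    using assms by (intro riesz_monom_mult_sum) (auto simp: polys_below_def)
  then show ?thesis by (simp add: scalar_prod_def atLeast0LessThan mult.commute)
qed

lemma polys_below_Suc_monic_diff:
  assumes "lead_coeff p = 1" "degree p = s"
  shows "monom 1 s - p \<in> polys_below s"
  using assms by (auto simp: polys_below_def coeff_eq_0 le_less)

text \<open>With g = x^(n+1) - p, the relations for k \<le> n are the system A g = u, and the one
  for k = n + 1 reads w_(2n+2) = u g. This is the origin of the value u^T A^(-1) u for the last
  moment.\<close>

lemma flat_extension_iff:
  assumes pd: "pd_mat (hank w 0 (Suc n))" and p: "lead_coeff p = 1" "degree p = Suc n"
  defines "u \<equiv> vec (Suc n) (\<lambda>i. w (Suc n + i))"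
  shows "(\<forall>k\<le>Suc n. riesz w (monom 1 k * p) = 0) \<longleftrightarrow>
    inv_mat (hank w 0 (Suc n)) *\<^sub>v u = vec (Suc n) (coeff (monom 1 (Suc n) - p)) \<and>
    w (2 * n + 2) = u \<bullet> vec (Suc n) (coeff (monom 1 (Suc n) - p))"
proof -
  let ?g = "monom 1 (Suc n) - p"
  have g: "?g \<in> polys_below (Suc n)" by (rule polys_below_Suc_monic_diff[OF p])
  have riesz: "riesz w (monom 1 k * p) = 0 \<longleftrightarrow> riesz w (monom 1 k * ?g) = w (Suc n + k)" for k
    by (auto simp: right_diff_distrib riesz_diff mult_monom riesz_monom add.commute)
  have "inv_mat (hank w 0 (Suc n)) *\<^sub>v u = vec (Suc n) (coeff ?g) \<longleftrightarrow>
      hank w 0 (Suc n) *\<^sub>v vec (Suc n) (coeff ?g) = u"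
    by (rule inv_mat_mult_vec_eq_iff[OF hank_carrier pd_mat_det_nonzero[OF hank_carrier pd]])
      (simp_all add: u_def)
  also have "\<dots> \<longleftrightarrow> (\<forall>k<Suc n. riesz w (monom 1 k * ?g) = w (Suc n + k))"
    unfolding hank_mult_vec[OF g] by (auto simp: u_def vec_eq_iff)
  finally have 1: "inv_mat (hank w 0 (Suc n)) *\<^sub>v u = vec (Suc n) (coeff ?g) \<longleftrightarrow>
      (\<forall>k<Suc n. riesz w (monom 1 k * p) = 0)" by (simp add: riesz)
  have "riesz w (monom 1 (Suc n) * ?g) = u \<bullet> vec (Suc n) (coeff ?g)"
    unfolding u_def by (rule riesz_monom_mult_vec[OF g])
  moreover have "Suc n + Suc n = 2 * n + 2" by simp
  ultimately have 2: "w (2 * n + 2) = u \<bullet> vec (Suc n) (coeff ?g) \<longleftrightarrow> riesz w (monom 1 (Suc n) * p) = 0"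
    using riesz[of "Suc n"] by metis
  show ?thesis unfolding 1 2 by (auto simp: le_less)
qed

lemma flat_extension_exists:
  assumes pd: "pd_mat (hank w 0 (Suc n))"
  defines "u \<equiv> vec (Suc n) (\<lambda>i. w (Suc n + i))"
  assumes w: "w (2 * n + 2) = u \<bullet> (inv_mat (hank w 0 (Suc n)) *\<^sub>v u)"
  obtains p where "lead_coeff p = 1" "degree p = Suc n" "\<And>k. k \<le> Suc n \<Longrightarrow> riesz w (monom 1 k * p) = 0"
proof -
  have "inv_mat (hank w 0 (Suc n)) *\<^sub>v u \<in> carrier_vec (Suc n)"
    using inv_mat(1)[OF hank_carrier pd_mat_det_nonzero[OF hank_carrier pd]]
    by (auto simp: u_def)
  then obtain g where g: "g \<in> polys_below (Suc n)" "inv_mat (hank w 0 (Suc n)) *\<^sub>v u = vec (Suc n) (coeff g)"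
    by (rule vec_coeff_surj)
  define p where "p = monom 1 (Suc n) - g"
  have coeff: "coeff p i = (if i = Suc n then 1 else - coeff g i)" if "i \<le> Suc n" for i
    using g(1) that by (auto simp: p_def polys_below_def)
  have "coeff p i = 0" if "i > Suc n" for i
    using g(1) that by (auto simp: p_def polys_below_def)
  then have deg: "degree p = Suc n"
    by (intro antisym degree_le le_degree) (auto simp: coeff)
  then have lead: "lead_coeff p = 1" by (simp add: coeff)
  have "monom 1 (Suc n) - p = g" by (simp add: p_def)
  then have "\<forall>k\<le>Suc n. riesz w (monom 1 k * p) = 0"
    using flat_extension_iff[OF pd lead deg] g(2) w unfolding u_def by simp
  with lead deg show ?thesis using that by blast
qed

text \<open>For the longer sequence the bound in \<open>is_generator\<close> is 2(n+1) - (n+1) = n +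
  1, exactly the range supplied, and definiteness of the old matrix is positivity below degree n +
  1.\<close>

lemma flat_extension_is_generator:
  assumes "pd_mat (hank w 0 (Suc n))" "lead_coeff p = 1" "degree p = Suc n"
    and "\<And>k. k \<le> Suc n \<Longrightarrow> riesz w (monom 1 k * p) = 0"
  shows "is_generator w (Suc n) p"
  using assms by (auto simp: is_generator_def pd_hank_iff)

text \<open>p(0) = 0 means x^(n+1) - p = x h with deg h < n. Then the relations for k < n read C h =
  v and the one for k = n reads w_(2n+1) = v h, which is the excluded value. For n = 0 the matrix C
  is empty, hence invertible, and that value is 0.\<close>

lemma flat_extension_coeff_0_iff:
  assumes pd: "pd_mat (hank w 0 (Suc n))" and p: "lead_coeff p = 1" "degree p = Suc n"
    and riesz: "\<And>k. k \<le> n \<Longrightarrow> riesz w (monom 1 k * p) = 0"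
  defines "C \<equiv> hank w 1 n" and "v \<equiv> vec n (\<lambda>i. w (Suc n + i))"
  shows "coeff p 0 = 0 \<longleftrightarrow> invertible_mat C \<and> w (2 * n + 1) = v \<bullet> (inv_mat C *\<^sub>v v)"
proof -
  let ?g = "monom 1 (Suc n) - p"
  have g: "?g \<in> polys_below (Suc n)" by (rule polys_below_Suc_monic_diff[OF p])
  have riesz_g: "riesz w (monom 1 k * ?g) = w (Suc n + k)" if "k \<le> n" for k
    using riesz[OF that] by (simp add: right_diff_distrib riesz_diff mult_monom riesz_monom add.commute)
  have C: "C \<in> carrier_mat n n" by (simp add: C_def)
  have v: "v \<in> carrier_vec n" by (simp add: v_def)
  have x: "monom 1 1 * h \<in> polys_below (Suc n)" if "h \<in> polys_below n" for h
    using polys_below_monom_mult[OF that, of 1] by simp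
  have mm: "monom 1 (1 + k) * h = monom 1 k * (monom 1 1 * h)" for k and h :: "real poly"
    by (simp add: mult_monom flip: mult.assoc)
  have last: "riesz w (monom 1 (Suc n) * h) = v \<bullet> vec n (coeff h)" if "h \<in> polys_below n" for h
    unfolding v_def by (rule riesz_monom_mult_vec[OF that])
  have Cv: "C *\<^sub>v vec n (coeff h) = v \<longleftrightarrow> (\<forall>k<n. riesz w (monom 1 (1 + k) * h) = w (Suc n + k))"
    if "h \<in> polys_below n" for h
    unfolding C_def hank_mult_vec[OF that] by (auto simp: v_def vec_eq_iff)
  show ?thesis
  proof
    assume "coeff p 0 = 0"
    then have g0: "coeff ?g 0 = 0" by simp
    define h where "h = poly_shift 1 ?g"
    have gh: "?g = monom 1 1 * h"
      using g0 by (intro poly_eqI) (simp add: h_def coeff_monom_mult coeff_poly_shift)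
    have h: "h \<in> polys_below n"
      using g by (auto simp: h_def polys_below_def coeff_poly_shift)
    have riesz_h: "riesz w (monom 1 (1 + k) * h) = w (Suc n + k)" if "k \<le> n" for k
      using riesz_g[OF that] unfolding gh mm .
    then have Ch: "C *\<^sub>v vec n (coeff h) = v" using Cv[OF h] by simp
    have b: "w (2 * n + 1) = v \<bullet> vec n (coeff h)"
      using riesz_h[of n] last[OF h] by (simp add: mult_2)
    have det: "det C \<noteq> 0"
    proof
      assume "det C = 0"
      then obtain y where y: "y \<in> hank_kernel w 1 n" "y \<noteq> 0"
        unfolding C_def det_hank_eq_0_iff by blast
      have yb: "y \<in> polys_below n" using y(1) by (simp add: hank_kernel_def)
      have ker: "riesz w (monom 1 k * (monom 1 1 * y)) = 0" if "k < n" for k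
        using y(1) that unfolding mm[symmetric] by (simp add: hank_kernel_def)
      \<comment> \<open>For y in the kernel of C, x y is orthogonal to x^k for k < n; the case k = n
        follows by symmetry of C, as v y = (C h) y = h (C y) = 0. So x y would be a nonzero kernel
        element of a definite matrix.\<close>
      have "riesz w (monom 1 n * (monom 1 1 * y)) = v \<bullet> vec n (coeff y)"
        unfolding mm[symmetric] using last[OF yb] by simp
      also have "\<dots> = vec n (coeff y) \<bullet> (hank w 1 n *\<^sub>v vec n (coeff h))"
        using Ch v by (simp add: C_def comm_scalar_prod[of _ n])
      also have "\<dots> = riesz w (h * (monom 1 1 * y))"
        unfolding hank_bilinear[OF yb h] by (simp add: mult_ac)
      also have "\<dots> = 0"
      proof (cases n)
        case 0
        then show ?thesis using h by simp
      next
        case (Suc m)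
        then show ?thesis by (intro riesz_mult_eq_0[of m, OF ker]) (use h in simp_all)
      qed
      finally have "riesz w (monom 1 k * (monom 1 1 * y)) = 0" if "k \<le> n" for k
        using ker[of k] that by (cases "k = n") auto
      then have "monom 1 1 * y \<in> hank_kernel w 0 (Suc n)"
        using x[OF yb] by (simp add: hank_kernel_def)
      moreover have "monom 1 1 * y \<noteq> 0" using y(2) by (simp add: monom_eq_0_iff)
      ultimately show False
        using pd_mat_det_nonzero[OF hank_carrier pd] det_hank_eq_0_iff by blast
    qed
    have "inv_mat C *\<^sub>v v = vec n (coeff h)"
      using Ch by (subst inv_mat_mult_vec_eq_iff[OF C det]) (simp_all add: v_def)
    with b det show "invertible_mat C \<and> w (2 * n + 1) = v \<bullet> (inv_mat C *\<^sub>v v)"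
      by (simp add: invertible_mat_iff_det_nonzero[OF C])
  next
    assume *: "invertible_mat C \<and> w (2 * n + 1) = v \<bullet> (inv_mat C *\<^sub>v v)"
    then have det: "det C \<noteq> 0" by (simp add: invertible_mat_iff_det_nonzero[OF C])
    have "inv_mat C *\<^sub>v v \<in> carrier_vec n" using inv_mat(1)[OF C det] v by auto
    then obtain h where h: "h \<in> polys_below n" "inv_mat C *\<^sub>v v = vec n (coeff h)"
      by (rule vec_coeff_surj)
    then have "C *\<^sub>v vec n (coeff h) = v"
      using inv_mat_mult_vec_eq_iff[OF C det _ v, of "vec n (coeff h)"] by simp
    then have "riesz w (monom 1 (1 + k) * h) = w (Suc n + k)" if "k < n" for k
      using Cv[OF h(1)] that by blast
    moreover have "riesz w (monom 1 (1 + n) * h) = w (Suc n + n)"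
      using * h(2) last[OF h(1)] by (simp add: mult_2)
    ultimately have "riesz w (monom 1 (1 + k) * h) = w (Suc n + k)" if "k \<le> n" for k
      using that by (cases "k = n") auto
    then have "riesz w (monom 1 k * (monom 1 1 * h)) = w (Suc n + k)" if "k \<le> n" for k
      using that unfolding mm[symmetric] by blast
    then have "riesz w (monom 1 k * (?g - monom 1 1 * h)) = 0" if "k \<le> n" for k
      using riesz_g that by (simp only: right_diff_distrib[of "monom 1 k" ?g] riesz_diff)
    \<comment> \<open>Both polynomials solve the same definite system, so they agree and x^(n+1) - p
      is a multiple of x.\<close>
    then have "?g - monom 1 1 * h \<in> hank_kernel w 0 (Suc n)"
      using polys_below_diff[OF g x[OF h(1)]] by (simp add: hank_kernel_def)
    then have "?g - monom 1 1 * h = 0"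
      using pd_mat_det_nonzero[OF hank_carrier pd] det_hank_eq_0_iff by blast
    then have "coeff ?g 0 = coeff (monom 1 1 * h) 0" by simp
    then show "coeff p 0 = 0" by (simp add: coeff_monom_mult)
  qed
qed

lemma pd_hank_iff_kernel:
  "pd_mat (hank w 0 s) \<longleftrightarrow> psd_mat (hank w 0 s) \<and> (\<forall>p\<in>hank_kernel w 0 s. p = 0)"
proof
  assume pd: "pd_mat (hank w 0 s)"
  have "riesz w (p * p) \<ge> 0" if "p \<in> polys_below s" for p
    using pd that by (cases "p = 0") (auto simp: pd_hank_iff less_imp_le)
  moreover have "\<forall>p\<in>hank_kernel w 0 s. p = 0"
    using pd_mat_det_nonzero[OF hank_carrier pd] det_hank_eq_0_iff by blast
  ultimately show "psd_mat (hank w 0 s) \<and> (\<forall>p\<in>hank_kernel w 0 s. p = 0)"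
    by (simp add: psd_hank_iff)
next
  assume *: "psd_mat (hank w 0 s) \<and> (\<forall>p\<in>hank_kernel w 0 s. p = 0)"
  show "pd_mat (hank w 0 s)"
    unfolding pd_hank_iff
  proof (intro ballI impI)
    fix p assume p: "p \<in> polys_below s" "p \<noteq> 0"
    then have "riesz w (monom 1 0 * (p * p)) \<noteq> 0" "riesz w (monom 1 0 * (p * p)) \<ge> 0"
      using * psd_hank_kernel_iff[of w 0 s p] psd_hank_iff[of w 0 s] by blast+
    then show "riesz w (monom 1 0 * (p * p)) > 0" by simp
  qed
qed

text \<open>Reversing w flips rows and columns of the Hankel matrix; on kernel polynomials this is
  the reversal of the n + 1 coefficients.\<close>

lemma hank_reverse_kernel_trivial:
  assumes "\<And>p. p \<in> hank_kernel w 0 (Suc n) \<Longrightarrow> p = 0"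
    and p: "p \<in> hank_kernel (\<lambda>i. w (2 * n - i)) 0 (Suc n)"
  shows "p = 0"
proof -
  define q where "q = (\<Sum>i\<le>n. monom (coeff p (n - i)) i)"
  have coeff: "coeff q i = (if i \<le> n then coeff p (n - i) else 0)" for i
    by (simp add: q_def coeff_sum)
  have "riesz w (monom 1 k * q) = 0" if k: "k \<le> n" for k
  proof -
    have "riesz w (monom 1 k * q) = (\<Sum>i\<in>{..n}. coeff q i * w (k + i))"
      by (rule riesz_monom_mult_sum) (auto simp: coeff)
    also have "\<dots> = (\<Sum>i\<in>{..n}. coeff p i * w (2 * n - (n - k + i)))"
      by (rule sum.reindex_bij_witness[of _ "\<lambda>i. n - i" "\<lambda>i. n - i"])
        (use k in \<open>auto simp: coeff intro!: arg_cong[where f = w]\<close>)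
    also have "\<dots> = riesz (\<lambda>i. w (2 * n - i)) (monom 1 (n - k) * p)"
      using p by (intro riesz_monom_mult_sum[symmetric]) (auto simp: hank_kernel_def polys_below_def)
    also have "\<dots> = 0" using p k by (simp add: hank_kernel_def)
    finally show ?thesis .
  qed
  then have "q \<in> hank_kernel w 0 (Suc n)"
    by (auto simp: hank_kernel_def polys_below_def coeff)
  then have "q = 0" by (rule assms(1))
  have "coeff p i = 0" for i
  proof (cases "i \<le> n")
    case True
    then show ?thesis using coeff[of "n - i"] \<open>q = 0\<close> by simp
  next
    case False
    then show ?thesis using p by (auto simp: hank_kernel_def polys_below_def)
  qed
  then show ?thesis by (simp add: poly_eq_iff)
qed

lemma pd_rec_gen:
  assumes pd: "pd_mat (hank w 0 (Suc n))"
  shows "seq_rank w n = n + 1" "rec_gen w n"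
proof -
  have ker: "p = 0" if "p \<in> hank_kernel w 0 (Suc n)" for p
    using pd that by (simp add: pd_hank_iff_kernel)
  show rank: "seq_rank w n = n + 1" using ker by (rule seq_rank_full)
  have "seq_rank (\<lambda>i. w (2 * n - i)) n = n + 1"
    using hank_reverse_kernel_trivial[OF ker] by (rule seq_rank_full)
  with pd show "rec_gen w n"
    by (simp add: rec_gen_def prg_def nrg_def rank)
qed

text \<open>The right-hand side is the common normal form to which existence of a measure and
  existence of an atomic one are reduced as well.\<close>

lemma rec_gen_iff:
  "rec_gen w n \<longleftrightarrow>
     pd_mat (hank w 0 (Suc n)) \<or> (\<exists>p. is_generator w n p \<and> coeff p 0 \<noteq> 0)"
proof
  assume rec: "rec_gen w n"
  show "pd_mat (hank w 0 (Suc n)) \<or> (\<exists>p. is_generator w n p \<and> coeff p 0 \<noteq> 0)"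
  proof (cases "seq_rank w n \<le> n")
    case True
    then have "is_generator w n (gen_poly w n)"
      using rec by (intro prg_is_generator) (simp_all add: rec_gen_def)
    moreover from this have "coeff (gen_poly w n) 0 \<noteq> 0"
      by (rule is_generator_nrg_imp_coeff_0) (use rec in \<open>simp add: rec_gen_def\<close>)
    ultimately show ?thesis by blast
  next
    case False
    then have "seq_rank w n = Suc n" using seq_rank_le[of w n] by simp
    with rec show ?thesis by (simp add: rec_gen_def prg_def Let_def)
  qed
next
  assume "pd_mat (hank w 0 (Suc n)) \<or> (\<exists>p. is_generator w n p \<and> coeff p 0 \<noteq> 0)"
  then show "rec_gen w n"
    using pd_rec_gen(2) is_generator_prg is_generator_nrg unfolding rec_gen_def by blast
qed

text \<open>The two required kernel elements are x^(n-r) p, of degree n, and p itself, with nonzero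
  constant term.\<close>

lemma generator_rank_conditions:
  assumes gen: "is_generator w n p" and p0: "coeff p 0 \<noteq> 0"
    and psd: "psd_mat (hank w 0 (Suc n))"
  shows "mat_rank (hank w 0 (Suc n)) = mat_rank (hank w 0 n)"
    and "mat_rank (hank w 0 (Suc n)) = mat_rank (hank w 2 n)"
proof -
  note ker = is_generator_in_kernel[OF gen]
  show "mat_rank (hank w 0 (Suc n)) = mat_rank (hank w 2 n)"
    unfolding mat_rank_hank_eq_tl_iff[OF psd] using ker(1) p0 by blast
  let ?q = "monom 1 (n - degree p) * p"
  have r: "degree p \<le> n" using gen by (simp add: is_generator_def)
  then have deg: "degree ?q = n" using ker(2) by (simp add: degree_mult_eq degree_monom_eq monom_eq_0_iff)
  have "riesz w (monom 1 k * ?q) = 0" if "k \<le> n" for k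
  proof -
    have eq: "monom 1 k * ?q = monom 1 (k + (n - degree p)) * p"
      by (simp add: mult_monom flip: mult.assoc)
    show ?thesis unfolding eq using gen that r by (simp add: is_generator_def)
  qed
  then have "?q \<in> hank_kernel w 0 (Suc n)"
    using deg by (simp add: hank_kernel_def polys_below_Suc_iff)
  moreover have "?q \<noteq> 0" using ker(2) by (simp add: monom_eq_0_iff)
  ultimately show "mat_rank (hank w 0 (Suc n)) = mat_rank (hank w 0 n)"
    unfolding mat_rank_hank_eq_butlast_iff[OF psd] using deg by blast
qed

lemma generator_rep_measure:
  assumes gen: "is_generator (wseq k1 \<beta>) (k1 + k2) p" and p0: "coeff p 0 \<noteq> 0"
  shows "beta_rank k1 k2 \<beta> = degree p"
    and "\<exists>!M. rep_measure k1 k2 \<beta> M"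
    and "rep_measure k1 k2 \<beta> M \<Longrightarrow>
      card {x. poly (beta_gen_poly k1 k2 \<beta>) x = 0} = beta_rank k1 k2 \<beta> \<and>
      (\<exists>\<rho>. discrete_measure_on M {x. poly (beta_gen_poly k1 k2 \<beta>) x = 0} \<rho>)"
    and "rep_measure k1 k2 \<beta> M \<Longrightarrow> atomic_measure M (degree p)"
proof -
  show rank: "beta_rank k1 k2 \<beta> = degree p"
    using is_generator_seq_rank[OF gen] by (simp add: beta_rank_def)
  have poly: "beta_gen_poly k1 k2 \<beta> = p"
    using is_generator_gen_poly[OF gen] by (simp add: beta_gen_poly_def)
  show "\<exists>!M. rep_measure k1 k2 \<beta> M"
    using is_generator_rep_measure_exists[OF gen p0] is_generator_rep_measure_unique[OF gen] by blast
  note discrete = is_generator_rep_measure_discrete[OF gen]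
  show "card {x. poly (beta_gen_poly k1 k2 \<beta>) x = 0} = beta_rank k1 k2 \<beta> \<and>
      (\<exists>\<rho>. discrete_measure_on M {x. poly (beta_gen_poly k1 k2 \<beta>) x = 0} \<rho>)"
    if "rep_measure k1 k2 \<beta> M"
    using discrete[OF that] unfolding rank poly by blast
  show "atomic_measure M (degree p)" if "rep_measure k1 k2 \<beta> M"
    using discrete[OF that] unfolding atomic_measure_def by blast
qed

section \<open>Parametrisation of the minimal measures in the definite case\<close>

definition admissible :: "nat \<Rightarrow> nat \<Rightarrow> (int \<Rightarrow> real) \<Rightarrow> real \<Rightarrow> bool" where
  "admissible k1 k2 \<beta> b1 \<longleftrightarrow>
     (let n = k1 + k2;
          A = Mb \<beta> (- int k1) (int k2);
          C = mat n n (\<lambda>(i,j). A $$ (i, j + 1));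
          v = vec n (\<lambda>i. \<beta> (- int k1 + int k2 + 1 + int i))
      in invertible_mat C \<longrightarrow> b1 \<noteq> v \<bullet> (inv_mat C *\<^sub>v v))"

text \<open>Like \<open>admissible\<close>, this repeats the local binding of the theorem, so that
  unfolding restores its statement.\<close>

definition flat_extension :: "nat \<Rightarrow> nat \<Rightarrow> (int \<Rightarrow> real) \<Rightarrow> real \<Rightarrow> int \<Rightarrow> real" where
  "flat_extension k1 k2 \<beta> b1 =
     (let n = k1 + k2;
          A = Mb \<beta> (- int k1) (int k2);
          u = vec (n + 1) (\<lambda>i. if i < n then \<beta> (- int k1 + int k2 + 1 + int i) else b1);
          b2 = u \<bullet> (inv_mat A *\<^sub>v u)
      in (\<lambda>i. if i = 2 * int k2 + 1 then b1 else if i = 2 * int k2 + 2 then b2 else \<beta> i))"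

text \<open>Stated for any w that continues the given sequence by b1, because it is applied both to
  the constructed extension and to the moments of a given atomic measure.\<close>

lemma admissible_iff:
  assumes w: "\<And>j. j \<le> 2 * (k1 + k2) \<Longrightarrow> w j = wseq k1 \<beta> j"
    and b1: "w (2 * (k1 + k2) + 1) = b1"
  defines "v \<equiv> vec (k1 + k2) (\<lambda>i. w (Suc (k1 + k2) + i))"
  shows "admissible k1 k2 \<beta> b1 \<longleftrightarrow> \<not> (invertible_mat (hank w 1 (k1 + k2)) \<and>
      w (2 * (k1 + k2) + 1) = v \<bullet> (inv_mat (hank w 1 (k1 + k2)) *\<^sub>v v))"
proof -
  have C: "mat (k1 + k2) (k1 + k2) (\<lambda>(i,j). Mb \<beta> (- int k1) (int k2) $$ (i, j + 1)) = hank w 1 (k1 + k2)"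
    unfolding Mb_eq_hank by (intro eq_matI) (auto simp: hank_def w)
  have v: "vec (k1 + k2) (\<lambda>i. \<beta> (- int k1 + int k2 + 1 + int i)) = v"
    unfolding v_def by (auto simp: vec_eq_iff w wseq_def intro!: arg_cong[where f = \<beta>])
  show ?thesis unfolding admissible_def Let_def C v b1 by blast
qed

lemma flat_extension_last:
  assumes w: "\<And>j. j \<le> 2 * (k1 + k2) \<Longrightarrow> w j = wseq k1 \<beta> j"
    and b1: "w (2 * (k1 + k2) + 1) = b1"
  defines "u \<equiv> vec (Suc (k1 + k2)) (\<lambda>i. w (Suc (k1 + k2) + i))"
  shows "flat_extension k1 k2 \<beta> b1 (2 * int k2 + 2) =
      u \<bullet> (inv_mat (hank w 0 (Suc (k1 + k2))) *\<^sub>v u)"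
proof -
  have A: "Mb \<beta> (- int k1) (int k2) = hank w 0 (Suc (k1 + k2))"
    unfolding Mb_eq_hank by (intro eq_matI) (auto simp: hank_def w)
  have u: "vec (k1 + k2 + 1) (\<lambda>i. if i < k1 + k2 then \<beta> (- int k1 + int k2 + 1 + int i) else b1) = u"
  proof (intro eq_vecI)
    fix i assume "i < dim_vec u"
    then have i: "i \<le> k1 + k2" by (simp add: u_def)
    show "vec (k1 + k2 + 1) (\<lambda>i. if i < k1 + k2 then \<beta> (- int k1 + int k2 + 1 + int i) else b1) $ i = u $ i"
    proof (cases "i < k1 + k2")
      case True
      then show ?thesis by (auto simp: u_def w wseq_def intro!: arg_cong[where f = \<beta>])
    next
      case False
      then have "i = k1 + k2" using i by simp
      then have "Suc (k1 + k2) + i = 2 * (k1 + k2) + 1" by simp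
      then have "w (Suc (k1 + k2) + i) = b1" using b1 by (simp only:)
      then show ?thesis using False i by (simp add: u_def)
    qed
  qed (simp add: u_def)
  show ?thesis unfolding flat_extension_def Let_def A u by simp
qed

lemma flat_extension_simps:
  "i \<le> 2 * int k2 \<Longrightarrow> flat_extension k1 k2 \<beta> b1 i = \<beta> i"
  "flat_extension k1 k2 \<beta> b1 (2 * int k2 + 1) = b1"
  by (simp_all add: flat_extension_def Let_def)

lemma wseq_flat_extension:
  "j \<le> 2 * (k1 + k2) \<Longrightarrow> wseq k1 (flat_extension k1 k2 \<beta> b1) j = wseq k1 \<beta> j"
  "wseq k1 (flat_extension k1 k2 \<beta> b1) (2 * (k1 + k2) + 1) = b1"
  "wseq k1 (flat_extension k1 k2 \<beta> b1) (2 * (k1 + k2) + 2) =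
     flat_extension k1 k2 \<beta> b1 (2 * int k2 + 2)"
proof -
  show "wseq k1 (flat_extension k1 k2 \<beta> b1) j = wseq k1 \<beta> j" if "j \<le> 2 * (k1 + k2)"
    using that by (simp add: wseq_def flat_extension_simps)
  have "int (2 * (k1 + k2) + 1) - 2 * int k1 = 2 * int k2 + 1"
    "int (2 * (k1 + k2) + 2) - 2 * int k1 = 2 * int k2 + 2" by simp_all
  then show "wseq k1 (flat_extension k1 k2 \<beta> b1) (2 * (k1 + k2) + 1) = b1"
    "wseq k1 (flat_extension k1 k2 \<beta> b1) (2 * (k1 + k2) + 2) =
     flat_extension k1 k2 \<beta> b1 (2 * int k2 + 2)"
    by (simp_all only: wseq_def flat_extension_simps)
qed

lemma hank_cong:
  assumes "\<And>j. j \<le> 2 * n \<Longrightarrow> w j = w' j"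
  shows "hank w 0 (Suc n) = hank w' 0 (Suc n)"
  using assms by (intro eq_matI) (auto simp: hank_def)

lemma flat_extension_generator:
  assumes pd: "pd_mat (hank (wseq k1 \<beta>) 0 (Suc (k1 + k2)))" and adm: "admissible k1 k2 \<beta> b1"
  shows "\<exists>p. is_generator (wseq k1 (flat_extension k1 k2 \<beta> b1)) (k1 + (k2 + 1)) p \<and>
    coeff p 0 \<noteq> 0 \<and> degree p = Suc (k1 + k2)"
proof -
  let ?w = "wseq k1 (flat_extension k1 k2 \<beta> b1)" and ?n = "k1 + k2"
  note w = wseq_flat_extension
  have pd': "pd_mat (hank ?w 0 (Suc ?n))"
    using pd hank_cong[of ?n ?w "wseq k1 \<beta>"] w(1) by simp
  have "?w (2 * ?n + 2) = vec (Suc ?n) (\<lambda>i. ?w (Suc ?n + i)) \<bullet>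
      (inv_mat (hank ?w 0 (Suc ?n)) *\<^sub>v vec (Suc ?n) (\<lambda>i. ?w (Suc ?n + i)))"
    unfolding w(3) by (rule flat_extension_last[OF w(1,2)])
  then obtain p where p: "lead_coeff p = 1" "degree p = Suc ?n"
      "\<And>k. k \<le> Suc ?n \<Longrightarrow> riesz ?w (monom 1 k * p) = 0"
    using flat_extension_exists[OF pd'] by blast
  have "coeff p 0 = 0 \<longleftrightarrow> \<not> admissible k1 k2 \<beta> b1"
    using flat_extension_coeff_0_iff[OF pd' p(1,2) p(3)]
      admissible_iff[of k1 k2 ?w \<beta> b1, OF w(1,2)] by simp
  with adm have "coeff p 0 \<noteq> 0" by simp
  moreover have "is_generator ?w (Suc ?n) p"
    using pd' p by (rule flat_extension_is_generator)
  ultimately show ?thesis using p(2) by auto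
qed

text \<open>The parameter b1 is the next moment of the given measure. Its node polynomial has degree
  n + 1 and generates the longer sequence, so the moment after that is forced; b1 is admissible
  because 0 is not a node.\<close>

lemma atomic_rep_measure_flat_extension:
  assumes pd: "pd_mat (hank (wseq k1 \<beta>) 0 (Suc (k1 + k2)))"
    and rep: "rep_measure k1 k2 \<beta> M" and atomic: "atomic_measure M (Suc (k1 + k2))"
  shows "\<exists>b1. admissible k1 k2 \<beta> b1 \<and> rep_measure k1 (k2 + 1) (flat_extension k1 k2 \<beta> b1) M"
proof -
  let ?n = "k1 + k2"
  obtain X \<rho> where X: "card X = Suc ?n" "discrete_measure_on M X \<rho>"
    using atomic by (auto simp: atomic_measure_def)
  have fin: "finite X" and pos: "\<And>x. x \<in> X \<Longrightarrow> \<rho> x > 0"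
    using X(2) by (auto simp: discrete_measure_on_def)
  have sets: "sets M = sets borel" and null: "emeasure M {0} = 0"
    using rep by (auto simp: rep_measure_def)
  have X0: "0 \<notin> X"
  proof
    assume "0 \<in> X"
    then have "emeasure M {0} = ennreal (\<rho> 0)"
      using X(2) sets by (simp add: discrete_measure_on_def Int_insert_right)
    with null pos[OF \<open>0 \<in> X\<close>] show False by simp
  qed
  \<comment> \<open>All moments of M, which extend \<beta> beyond the prescribed range.\<close>
  define \<beta>' where "\<beta>' = (\<lambda>i. \<Sum>x\<in>X. \<rho> x * x powi i)"
  have rep': "rep_measure k1 (k2 + 1) \<beta>' M"
    by (rule discrete_rep_measureI[OF sets X(2) X0]) (simp add: \<beta>'_def)
  have \<beta>: "\<beta>' i = \<beta> i" if "i \<in> {- 2 * int k1..2 * int k2}" for i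
    using rep that discrete_measure_on_integral(2)[OF sets X(2) borel_measurable_power_int[of i]]
    by (auto simp: rep_measure_def \<beta>'_def)
  let ?w = "wseq k1 \<beta>'"
  have w: "?w j = wseq k1 \<beta> j" if "j \<le> 2 * ?n" for j
    using that \<beta> by (simp add: wseq_def)
  define b1 where "b1 = ?w (2 * ?n + 1)"
  let ?p = "\<Prod>x\<in>X. [:- x, 1:]"
  note p = prod_linear_poly[OF fin]
  have gen: "is_generator ?w (Suc ?n) ?p"
  proof (rule atomic_is_generator[OF fin])
    show "card X \<le> Suc ?n" using X(1) by simp
    show "0 < \<rho> x * x powi (- 2 * int k1)" if "x \<in> X" for x
    proof -
      have "x \<noteq> 0" using that X0 by auto
      then show ?thesis unfolding power_int_neg_even using pos[OF that] by simp
    qed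
    show "?w j = (\<Sum>x\<in>X. \<rho> x * x powi (- 2 * int k1) * x ^ j)" for j
      using X0 by (rule wseq_atomic) (simp add: \<beta>'_def)
  qed
  have lead: "lead_coeff ?p = 1" and deg: "degree ?p = Suc ?n" using p(1,2) X(1) by simp_all
  have riesz: "riesz ?w (monom 1 k * ?p) = 0" if "k \<le> Suc ?n" for k
    using gen that unfolding is_generator_def deg by simp
  have pd': "pd_mat (hank ?w 0 (Suc ?n))"
    using pd hank_cong[of ?n ?w "wseq k1 \<beta>"] w by simp
  have "poly ?p 0 \<noteq> 0" using X0 fin by (auto simp: poly_prod prod_zero_iff)
  then have "coeff ?p 0 \<noteq> 0" by (simp add: poly_0_coeff_0)
  then have adm: "admissible k1 k2 \<beta> b1"
    unfolding b1_def using flat_extension_coeff_0_iff[OF pd' lead deg] riesz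
    by (subst admissible_iff[OF w refl]) auto
  \<comment> \<open>The atomic moments satisfy the flatness relations, and these determine the entry
    at 2n + 2 from the earlier ones.\<close>
  have "?w (2 * ?n + 2) = flat_extension k1 k2 \<beta> b1 (2 * int k2 + 2)"
  proof -
    have "flat_extension k1 k2 \<beta> b1 (2 * int k2 + 2) = vec (Suc ?n) (\<lambda>i. ?w (Suc ?n + i)) \<bullet>
        (inv_mat (hank ?w 0 (Suc ?n)) *\<^sub>v vec (Suc ?n) (\<lambda>i. ?w (Suc ?n + i)))"
      by (rule flat_extension_last) (simp_all only: w b1_def)
    then show ?thesis using flat_extension_iff[OF pd' lead deg] riesz by metis
  qed
  moreover have "int (2 * ?n + 1) - 2 * int k1 = 2 * int k2 + 1"
    "int (2 * ?n + 2) - 2 * int k1 = 2 * int k2 + 2" by simp_all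
  ultimately have top: "\<beta>' (2 * int k2 + 1) = b1"
      "\<beta>' (2 * int k2 + 2) = flat_extension k1 k2 \<beta> b1 (2 * int k2 + 2)"
    unfolding b1_def wseq_def by metis+
  have "flat_extension k1 k2 \<beta> b1 i = \<beta>' i" if i: "i \<in> {- 2 * int k1..2 * int (k2 + 1)}" for i
  proof -
    consider "i \<in> {- 2 * int k1..2 * int k2}" | "i = 2 * int k2 + 1" | "i = 2 * int k2 + 2"
      using i by force
    then show ?thesis
      using top \<beta> by cases (simp_all add: flat_extension_simps)
  qed
  then have "rep_measure k1 (k2 + 1) (flat_extension k1 k2 \<beta> b1) M"
    using rep' by (simp add: rep_measure_def)
  with adm show ?thesis by blast
qed

lemma rep_measure_flat_extension_restrict:
  assumes "rep_measure k1 (k2 + 1) (flat_extension k1 k2 \<beta> b1) M"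
  shows "rep_measure k1 k2 \<beta> M"
  unfolding rep_measure_def
proof (intro conjI ballI)
  show "sets M = sets borel" "emeasure M {0} = 0" using assms by (simp_all add: rep_measure_def)
  fix i assume i: "i \<in> {- 2 * int k1..2 * int k2}"
  then have "i \<in> {- 2 * int k1..2 * int (k2 + 1)}" by simp
  then have "integrable M (\<lambda>x. x powi i) \<and> (\<integral>x. x powi i \<partial>M) = flat_extension k1 k2 \<beta> b1 i"
    using assms unfolding rep_measure_def by blast
  then show "integrable M (\<lambda>x. x powi i)" "(\<integral>x. x powi i \<partial>M) = \<beta> i"
    using i flat_extension_simps(1)[of i k2] by auto
qed

text \<open>The measure built from b1 has b1 as its moment of order 2 k2 + 1. Finitely many measures
  would thus leave finitely many admissible values.\<close>

lemma pd_rep_measures: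
  assumes pd: "pd_mat (hank (wseq k1 \<beta>) 0 (Suc (k1 + k2)))"
  shows "infinite {M. rep_measure k1 k2 \<beta> M \<and> atomic_measure M (Suc (k1 + k2))}" (is "infinite ?S")
proof
  assume fin: "finite ?S"
  let ?m = "\<lambda>M. \<integral>x. x powi (2 * int k2 + 1) \<partial>M"
  have "{b1. admissible k1 k2 \<beta> b1} \<subseteq> ?m ` ?S"
  proof
    fix b1 assume "b1 \<in> {b1. admissible k1 k2 \<beta> b1}"
    then obtain p where p: "is_generator (wseq k1 (flat_extension k1 k2 \<beta> b1)) (k1 + (k2 + 1)) p"
      "coeff p 0 \<noteq> 0" "degree p = Suc (k1 + k2)"
      using flat_extension_generator[OF pd] by blast
    obtain M where M: "rep_measure k1 (k2 + 1) (flat_extension k1 k2 \<beta> b1) M"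
      using generator_rep_measure(2)[OF p(1,2)] by blast
    have "atomic_measure M (Suc (k1 + k2))"
      using generator_rep_measure(4)[OF p(1,2) M] p(3) by simp
    then have "M \<in> ?S" using rep_measure_flat_extension_restrict[OF M] by simp
    moreover have "2 * int k2 + 1 \<in> {- 2 * int k1..2 * int (k2 + 1)}" by simp
    then have "?m M = b1" using M flat_extension_simps(2) unfolding rep_measure_def by metis
    ultimately show "b1 \<in> ?m ` ?S" by blast
  qed
  then have "finite {b1. admissible k1 k2 \<beta> b1}" using fin finite_surj by blast
  \<comment> \<open>Admissibility excludes at most the single value v^T C^(-1) v.\<close>
  moreover have "\<exists>c. {b1. \<not> admissible k1 k2 \<beta> b1} \<subseteq> {c}"
    unfolding admissible_def Let_def by blast
  then have "finite {b1. \<not> admissible k1 k2 \<beta> b1}" using finite_subset by blast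
  ultimately have "finite ({b1. admissible k1 k2 \<beta> b1} \<union> {b1. \<not> admissible k1 k2 \<beta> b1})" by simp
  moreover have "{b1. admissible k1 k2 \<beta> b1} \<union> {b1. \<not> admissible k1 k2 \<beta> b1} = UNIV" by blast
  ultimately show False using infinite_UNIV_char_0[where ?'a = real] by simp
qed

section \<open>The equivalences and the assembly of the theorem\<close>

lemma rep_measure_cases:
  assumes "rep_measure k1 k2 \<beta> M"
  obtains "pd_mat (hank (wseq k1 \<beta>) 0 (Suc (k1 + k2)))"
    | p where "is_generator (wseq k1 \<beta>) (k1 + k2) p" "coeff p 0 \<noteq> 0"
proof (cases "pd_mat (hank (wseq k1 \<beta>) 0 (Suc (k1 + k2)))")
  case True
  then show ?thesis by (rule that(1))
next
  case False
  then obtain e where "e \<in> hank_kernel (wseq k1 \<beta>) 0 (Suc (k1 + k2))" "e \<noteq> 0"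
    using rep_measure_psd[OF assms] by (auto simp: pd_hank_iff_kernel)
  then obtain p where "is_generator (wseq k1 \<beta>) (k1 + k2) p" "coeff p 0 \<noteq> 0"
    using rep_measure_is_generator[OF assms] by blast
  then show ?thesis by (rule that(2))
qed

lemma rep_measure_exists_iff:
  "(\<exists>M. rep_measure k1 k2 \<beta> M) \<longleftrightarrow>
     pd_mat (hank (wseq k1 \<beta>) 0 (Suc (k1 + k2))) \<or>
     (\<exists>p. is_generator (wseq k1 \<beta>) (k1 + k2) p \<and> coeff p 0 \<noteq> 0)" (is "?ex \<longleftrightarrow> ?pd \<or> ?gen")
  and atomic_rep_measure_exists_iff:
  "(\<exists>M. rep_measure k1 k2 \<beta> M \<and> atomic_measure M (beta_rank k1 k2 \<beta>)) \<longleftrightarrow>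
     pd_mat (hank (wseq k1 \<beta>) 0 (Suc (k1 + k2))) \<or>
     (\<exists>p. is_generator (wseq k1 \<beta>) (k1 + k2) p \<and> coeff p 0 \<noteq> 0)" (is "?at \<longleftrightarrow> _")
proof -
  have 1: "?pd \<or> ?gen" if "rep_measure k1 k2 \<beta> M" for M
    using that by (cases rule: rep_measure_cases) blast+
  have 2: ?at if ?pd
  proof -
    have "{M. rep_measure k1 k2 \<beta> M \<and> atomic_measure M (Suc (k1 + k2))} \<noteq> {}"
      using pd_rep_measures[OF that] by (metis finite.emptyI)
    then show ?thesis using pd_rec_gen(1)[OF that] by (auto simp: beta_rank_def)
  qed
  have 3: ?at if ?gen
  proof -
    from that obtain p where p: "is_generator (wseq k1 \<beta>) (k1 + k2) p" "coeff p 0 \<noteq> 0" by blast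
    obtain M where M: "rep_measure k1 k2 \<beta> M" using generator_rep_measure(2)[OF p] by blast
    have "atomic_measure M (beta_rank k1 k2 \<beta>)"
      using generator_rep_measure(4)[OF p M] by (simp only: generator_rep_measure(1)[OF p])
    with M show ?thesis by blast
  qed
  have 4: ?ex if ?at using that by blast
  show "?ex \<longleftrightarrow> ?pd \<or> ?gen"
  proof
    assume ?ex
    then obtain M where "rep_measure k1 k2 \<beta> M" by (rule exE)
    then show "?pd \<or> ?gen" by (rule 1)
  next
    assume "?pd \<or> ?gen"
    then have ?at by (elim disjE) (rule 2 3, assumption)+
    then show ?ex by (rule 4)
  qed
  show "?at \<longleftrightarrow> ?pd \<or> ?gen"
  proof
    assume ?at
    then obtain M where "rep_measure k1 k2 \<beta> M" by blast
    then show "?pd \<or> ?gen" by (rule 1)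
  next
    assume "?pd \<or> ?gen"
    then show ?at by (elim disjE) (rule 2 3, assumption)+
  qed
qed

theorem theorem3p1:
  fixes k1 k2 :: nat and \<beta> :: "int \<Rightarrow> real"
  assumes pos: "\<beta> (- 2 * int k1) > 0"
  shows
   "((\<exists>M. rep_measure k1 k2 \<beta> M) \<longleftrightarrow>
       (\<exists>M. rep_measure k1 k2 \<beta> M \<and> atomic_measure M (beta_rank k1 k2 \<beta>))) \<and>
    ((\<exists>M. rep_measure k1 k2 \<beta> M) \<longleftrightarrow> beta_rec_gen k1 k2 \<beta>) \<and>
    ((\<exists>M. rep_measure k1 k2 \<beta> M) \<longleftrightarrow>
       psd_mat (Mb \<beta> (- int k1) (int k2)) \<and>
       (pd_mat (Mb \<beta> (- int k1) (int k2)) \<or>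
        (mat_rank (Mb \<beta> (- int k1) (int k2)) = mat_rank (Mb \<beta> (- int k1) (int k2 - 1)) \<and>
         mat_rank (Mb \<beta> (- int k1) (int k2)) = mat_rank (Mb \<beta> (- int k1 + 1) (int k2))))) \<and>
    ((\<exists>M. rep_measure k1 k2 \<beta> M) \<longrightarrow>
      (beta_rank k1 k2 \<beta> \<le> k1 + k2 \<longrightarrow>
         (\<exists>!M. rep_measure k1 k2 \<beta> M) \<and>
         (\<forall>M. rep_measure k1 k2 \<beta> M \<longrightarrow>
            (let X = {x. poly (beta_gen_poly k1 k2 \<beta>) x = 0} in
             card X = beta_rank k1 k2 \<beta> \<and> (\<exists>\<rho>. discrete_measure_on M X \<rho>)))) \<and>
      (beta_rank k1 k2 \<beta> = k1 + k2 + 1 \<longrightarrow>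
        (let n = k1 + k2;
             A = Mb \<beta> (- int k1) (int k2);
             C = mat n n (\<lambda>(i,j). A $$ (i, j + 1));
             v = vec n (\<lambda>i. \<beta> (- int k1 + int k2 + 1 + int i));
             admissible = (\<lambda>b1::real. invertible_mat C \<longrightarrow> b1 \<noteq> v \<bullet> (inv_mat C *\<^sub>v v));
             ext = (\<lambda>b1::real.
                let u = vec (n + 1) (\<lambda>i. if i < n then \<beta> (- int k1 + int k2 + 1 + int i) else b1);
                    b2 = u \<bullet> (inv_mat A *\<^sub>v u)
                in (\<lambda>i. if i = 2 * int k2 + 1 then b1 else if i = 2 * int k2 + 2 then b2 else \<beta> i))
         in infinite {M. rep_measure k1 k2 \<beta> M \<and> atomic_measure M (n + 1)} \<and>
            (\<forall>b1. admissible b1 \<longrightarrow>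
               (\<exists>!M. rep_measure k1 (k2 + 1) (ext b1) M) \<and>
               (\<forall>M. rep_measure k1 (k2 + 1) (ext b1) M \<longrightarrow>
                  rep_measure k1 k2 \<beta> M \<and> atomic_measure M (n + 1) \<and>
                  (let X = {x. poly (beta_gen_poly k1 (k2 + 1) (ext b1)) x = 0} in
                   card X = beta_rank k1 (k2 + 1) (ext b1) \<and> (\<exists>\<rho>. discrete_measure_on M X \<rho>)))) \<and>
            (\<forall>M. rep_measure k1 k2 \<beta> M \<and> atomic_measure M (n + 1) \<longrightarrow>
               (\<exists>b1. admissible b1 \<and> rep_measure k1 (k2 + 1) (ext b1) M)))))"
proof -
  let ?w = "wseq k1 \<beta>" and ?n = "k1 + k2"
  let ?A = "hank ?w 0 (Suc ?n)"
  have atomic: "(\<exists>M. rep_measure k1 k2 \<beta> M) \<longleftrightarrow>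
      (\<exists>M. rep_measure k1 k2 \<beta> M \<and> atomic_measure M (beta_rank k1 k2 \<beta>))"
    by (simp only: rep_measure_exists_iff atomic_rep_measure_exists_iff)
  have rec: "(\<exists>M. rep_measure k1 k2 \<beta> M) \<longleftrightarrow> beta_rec_gen k1 k2 \<beta>"
    by (simp only: rep_measure_exists_iff beta_rec_gen_def rec_gen_iff)
  have flat: "(\<exists>M. rep_measure k1 k2 \<beta> M) \<longleftrightarrow> psd_mat ?A \<and>
      (pd_mat ?A \<or> mat_rank ?A = mat_rank (hank ?w 0 ?n) \<and> mat_rank ?A = mat_rank (hank ?w 2 ?n))"
  proof
    assume "\<exists>M. rep_measure k1 k2 \<beta> M"
    then obtain M where M: "rep_measure k1 k2 \<beta> M" by blast
    note psd = rep_measure_psd[OF M]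
    from M show "psd_mat ?A \<and>
      (pd_mat ?A \<or> mat_rank ?A = mat_rank (hank ?w 0 ?n) \<and> mat_rank ?A = mat_rank (hank ?w 2 ?n))"
      by (cases rule: rep_measure_cases) (use psd generator_rank_conditions in blast)+
  next
    assume R: "psd_mat ?A \<and>
      (pd_mat ?A \<or> mat_rank ?A = mat_rank (hank ?w 0 ?n) \<and> mat_rank ?A = mat_rank (hank ?w 2 ?n))"
    show "\<exists>M. rep_measure k1 k2 \<beta> M"
    proof (cases "pd_mat ?A")
      case True
      then show ?thesis by (simp add: rep_measure_exists_iff)
    next
      case False
      \<comment> \<open>The two rank equalities provide e of degree n and f with nonzero constant
        term.\<close>
      then obtain e f where "e \<in> hank_kernel ?w 0 (Suc ?n)" "e \<noteq> 0" "degree e = ?n"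
        "f \<in> hank_kernel ?w 0 (Suc ?n)" "coeff f 0 \<noteq> 0"
        using R mat_rank_hank_eq_butlast_iff mat_rank_hank_eq_tl_iff by blast
      then have "\<exists>p. is_generator ?w ?n p \<and> coeff p 0 \<noteq> 0"
        using R by (intro psd_flat_is_generator) auto
      then show ?thesis by (simp add: rep_measure_exists_iff)
    qed
  qed
  have singular: "(\<exists>!M. rep_measure k1 k2 \<beta> M) \<and>
      (\<forall>M. rep_measure k1 k2 \<beta> M \<longrightarrow>
        card {x. poly (beta_gen_poly k1 k2 \<beta>) x = 0} = beta_rank k1 k2 \<beta> \<and>
        (\<exists>\<rho>. discrete_measure_on M {x. poly (beta_gen_poly k1 k2 \<beta>) x = 0} \<rho>))"
    if ex: "\<exists>M. rep_measure k1 k2 \<beta> M" and rank: "beta_rank k1 k2 \<beta> \<le> ?n"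
  proof -
    obtain M where M: "rep_measure k1 k2 \<beta> M" using ex by blast
    have npd: "\<not> pd_mat ?A" using rank pd_rec_gen(1)[of ?w ?n] by (auto simp: beta_rank_def)
    from M obtain p where "is_generator ?w ?n p" "coeff p 0 \<noteq> 0"
      by (cases rule: rep_measure_cases) (use npd in blast)+
    then show ?thesis using generator_rep_measure(2,3) by blast
  qed
  have regular: "infinite {M. rep_measure k1 k2 \<beta> M \<and> atomic_measure M (?n + 1)} \<and>
      (\<forall>b1. admissible k1 k2 \<beta> b1 \<longrightarrow>
         (\<exists>!M. rep_measure k1 (k2 + 1) (flat_extension k1 k2 \<beta> b1) M) \<and>
         (\<forall>M. rep_measure k1 (k2 + 1) (flat_extension k1 k2 \<beta> b1) M \<longrightarrow>
            rep_measure k1 k2 \<beta> M \<and> atomic_measure M (?n + 1) \<and>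
            card {x. poly (beta_gen_poly k1 (k2 + 1) (flat_extension k1 k2 \<beta> b1)) x = 0} =
              beta_rank k1 (k2 + 1) (flat_extension k1 k2 \<beta> b1) \<and>
            (\<exists>\<rho>. discrete_measure_on M
              {x. poly (beta_gen_poly k1 (k2 + 1) (flat_extension k1 k2 \<beta> b1)) x = 0} \<rho>))) \<and>
      (\<forall>M. rep_measure k1 k2 \<beta> M \<and> atomic_measure M (?n + 1) \<longrightarrow>
         (\<exists>b1. admissible k1 k2 \<beta> b1 \<and> rep_measure k1 (k2 + 1) (flat_extension k1 k2 \<beta> b1) M))"
    if rep: "\<exists>M. rep_measure k1 k2 \<beta> M" and rank: "beta_rank k1 k2 \<beta> = ?n + 1"
  proof (intro conjI allI impI)
    obtain M where M: "rep_measure k1 k2 \<beta> M" using rep by blast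
    then have pd: "pd_mat ?A"
    proof (cases rule: rep_measure_cases)
      \<comment> \<open>A generator has degree at most n and this degree is the rank, so full rank
        leaves only the definite case.\<close>
      case (2 p)
      then have "beta_rank k1 k2 \<beta> \<le> ?n"
        using generator_rep_measure(1) by (metis is_generator_def)
      with rank show ?thesis by simp
    qed
    show "infinite {M. rep_measure k1 k2 \<beta> M \<and> atomic_measure M (?n + 1)}"
      using pd_rep_measures[OF pd] by simp
    show "\<exists>b1. admissible k1 k2 \<beta> b1 \<and> rep_measure k1 (k2 + 1) (flat_extension k1 k2 \<beta> b1) M"
      if "rep_measure k1 k2 \<beta> M \<and> atomic_measure M (?n + 1)" for M
      using atomic_rep_measure_flat_extension[OF pd] that by simp
    fix b1 assume "admissible k1 k2 \<beta> b1"
    then obtain p where p: "is_generator (wseq k1 (flat_extension k1 k2 \<beta> b1)) (k1 + (k2 + 1)) p"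
      "coeff p 0 \<noteq> 0" "degree p = Suc ?n"
      using flat_extension_generator[OF pd] by blast
    note ext = generator_rep_measure[OF p(1,2)]
    show "\<exists>!M. rep_measure k1 (k2 + 1) (flat_extension k1 k2 \<beta> b1) M" by (rule ext(2))
    fix M assume M: "rep_measure k1 (k2 + 1) (flat_extension k1 k2 \<beta> b1) M"
    show "rep_measure k1 k2 \<beta> M" using M by (rule rep_measure_flat_extension_restrict)
    show "atomic_measure M (?n + 1)" using ext(4)[OF M] p(3) by simp
    show "card {x. poly (beta_gen_poly k1 (k2 + 1) (flat_extension k1 k2 \<beta> b1)) x = 0} =
        beta_rank k1 (k2 + 1) (flat_extension k1 k2 \<beta> b1)"
      and "\<exists>\<rho>. discrete_measure_on M
        {x. poly (beta_gen_poly k1 (k2 + 1) (flat_extension k1 k2 \<beta> b1)) x = 0} \<rho>"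
      using ext(3)[OF M] by blast+
  qed
  show ?thesis
    \<comment> \<open>Once the local bindings are gone, unfolding \<open>admissible\<close> and
      \<open>flat_extension\<close> in \<open>regular\<close> gives the last conjunct of the
      statement.\<close>
    unfolding Let_def
    by (intro conjI[OF atomic] conjI[OF rec] conjI[OF flat[folded Mb_eq_hank]] impI,
        rule conjI[OF impI[OF singular] impI[OF regular[unfolded admissible_def flat_extension_def Let_def]]])
qed

end
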